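(* Let $H$ be a complex separable infinite-dimensional Hilbert space and let $T$ be a closed densely defined operator in $H$. Then every member of the family $\Sigma(T)=\{\sigma^f(T)\}\cup\{\sigma^j_{n,m}(T): j\in\{0,1\},\ n,m\in\{0,1,2,\ldots,\infty\}\}$ is a Borel subset of $\mathbb{C}$. Moreover, $\sigma^f(T)$ has at most one element, and for all $j\in\{0,1\}$ and $n,m\in\{0,1,2,\ldots,\infty\}$ the set $\sigma^j_{n,m}(T)\subset\mathbb{C}$ is of the same Borel class as the corresponding set $\Sigma^j_{n,m}(H)\subset B(H)$ (with respect to the norm topology of $B(H)$).
   Context: An operator in $H$ is a linear map $T\colon D(T)\to H$ defined on a linear subspace $D(T)$ of $H$; it is closed if its graph is closed in $H\times H$. $N(\cdot)$, $R(\cdot)$ and $\overline{R}(\cdot)$ denote kernel, range and closure of the range. $B(H)$ is the algebra of bounded linear operators on $H$. Since $H$ is separable, dimensions are elements of $\{0,1,2,\ldots,\infty\}$. Subsets of $B(H)$: for $n,m\in\{0,1,2,\ldots,\infty\}$, $\Sigma^1_{n,m}(H)$ (respectively $\Sigma^0_{n,m}(H)$) is the set of all $A\in B(H)$ with $\dim N(A)=n$, $\dim R(A)^\perp=m$, $\dim\overline{R}(A)=\infty$ and $R(A)$ closed (respectively not closed). Subsets of $\mathbb{C}$: $\sigma^f(T)=\{z\in\mathbb{C}: R(T-z)\text{ is finite-dimensional}\}$; for $n,m\in\{0,1,2,\ldots,\infty\}$, $\sigma^1_{n,m}(T)$ (respectively $\sigma^0_{n,m}(T)$) is the set of all $z\in\mathbb{C}$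 with $\dim N(T-z)=n$, $\dim R(T-z)^\perp=m$, $\dim\overline{R}(T-z)=\infty$ and $R(T-z)$ closed (respectively not closed). Here $T-z$ has domain $D(T)$. "Of the same Borel class" means: for each class among the additive and multiplicative classes of the Borel hierarchy (open, closed, $F_\sigma$, $G_\delta$, $F_{\sigma\delta}$, $G_{\delta\sigma}$, etc.), as well as the classes $F\cap G$ (intersections of a closed and an open set) and $F_\sigma\cap G_\delta$ (intersections of an $F_\sigma$ and a $G_\delta$ set), if $\Sigma^j_{n,m}(H)$ belongs to this class in $B(H)$ then $\sigma^j_{n,m}(T)$ belongs to this class in $\mathbb{C}$. *)

theory Defs
  imports "HOL-Analysis.Analysis"
begin

section \<open>Complex Hilbert spaces\<close>

class complex_vector = real_vector +
  fixes scaleC :: "complex \<Rightarrow> 'a \<Rightarrow> 'a"  (infixr "*\<^sub>C" 75)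
  assumes scaleC_add_right: "a *\<^sub>C (x + y) = a *\<^sub>C x + a *\<^sub>C y"
    and scaleC_add_left: "(a + b) *\<^sub>C x = a *\<^sub>C x + b *\<^sub>C x"
    and scaleC_scaleC: "a *\<^sub>C b *\<^sub>C x = (a * b) *\<^sub>C x"
    and scaleC_one: "1 *\<^sub>C x = x"
    and scaleR_scaleC: "r *\<^sub>R x = complex_of_real r *\<^sub>C x"

global_interpretation complex_vector:
  vector_space "scaleC :: complex \<Rightarrow> 'a \<Rightarrow> 'a::complex_vector"
  defines csubspace = complex_vector.subspace
    and cspan = complex_vector.span
    and cdim = complex_vector.dim
  by unfold_locales
    (simp_all add: scaleC_add_right scaleC_add_left scaleC_scaleC scaleC_one)

text \<open>The real inner product is the real part of the complex one, so the norm, the metric and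
  positive definiteness of the complex inner product come from \<^class>\<open>real_inner\<close>.\<close>

class complex_hilbert = complex_vector + real_inner + complete_space +
  fixes cinner :: "'a \<Rightarrow> 'a \<Rightarrow> complex"
  assumes cinner_commute: "cinner x y = cnj (cinner y x)"
    and cinner_add_left: "cinner (x + y) z = cinner x z + cinner y z"
    and cinner_scaleC_left: "cinner (a *\<^sub>C x) y = a * cinner x y"
    and inner_eq_Re_cinner: "inner x y = Re (cinner x y)"

definition corthogonal_complement :: "'h::complex_hilbert set \<Rightarrow> 'h set"
  where "corthogonal_complement S = {x. \<forall>y\<in>S. cinner x y = 0}"

text \<open>In a separable Hilbert space, the Hilbert dimension of a closed subspace is the algebraic
  dimension if that is finite, and the countably infinite cardinal otherwise.\<close>

definition hdim :: "'h::complex_vector set \<Rightarrow> enat"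
  where "hdim S = (if \<exists>B. finite B \<and> S \<subseteq> cspan B then enat (cdim S) else \<infinity>)"


section \<open>Operators\<close>

text \<open>An operator is given by its domain \<open>D\<close> and a function \<open>T\<close> of which only the values on \<open>D\<close>
  matter.\<close>

definition is_operator :: "'h::complex_hilbert set \<Rightarrow> ('h \<Rightarrow> 'h) \<Rightarrow> bool"
  where "is_operator D T \<longleftrightarrow> csubspace D \<and>
    (\<forall>x\<in>D. \<forall>y\<in>D. T (x + y) = T x + T y) \<and> (\<forall>c. \<forall>x\<in>D. T (c *\<^sub>C x) = c *\<^sub>C T x)"

definition closed_operator :: "'h::complex_hilbert set \<Rightarrow> ('h \<Rightarrow> 'h) \<Rightarrow> bool"
  where "closed_operator D T \<longleftrightarrow> is_operator D T \<and> closed {(x, T x) |x. x \<in> D}"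

definition densely_defined :: "'h::complex_hilbert set \<Rightarrow> bool"
  where "densely_defined D \<longleftrightarrow> closure D = UNIV"

definition op_kernel :: "'h::complex_hilbert set \<Rightarrow> ('h \<Rightarrow> 'h) \<Rightarrow> 'h set"
  where "op_kernel D T = {x \<in> D. T x = 0}"

definition op_range :: "'h::complex_hilbert set \<Rightarrow> ('h \<Rightarrow> 'h) \<Rightarrow> 'h set"
  where "op_range D T = T ` D"

text \<open>The conditions common to \<open>\<Sigma>\<^sup>j\<close> and \<open>\<sigma>\<^sup>j\<close> with indices \<open>n, m\<close>: the value \<open>j = 1\<close> stands for
  closed range, \<open>j = 0\<close> for non-closed range.\<close>

definition op_type :: "nat \<Rightarrow> enat \<Rightarrow> enat \<Rightarrow> 'h::complex_hilbert set \<Rightarrow> ('h \<Rightarrow> 'h) \<Rightarrow> bool"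
  where "op_type j n m D T \<longleftrightarrow>
    hdim (op_kernel D T) = n \<and>
    hdim (corthogonal_complement (op_range D T)) = m \<and>
    hdim (closure (op_range D T)) = \<infinity> \<and>
    (if j = 1 then closed (op_range D T) else \<not> closed (op_range D T))"

text \<open>\<open>B(H)\<close> is the set of complex-linear elements of the space of bounded real-linear operators;
  its norm topology is the subspace topology.\<close>

definition BH :: "('h::complex_hilbert \<Rightarrow>\<^sub>L 'h) set"
  where "BH = {A. \<forall>c x. blinfun_apply A (c *\<^sub>C x) = c *\<^sub>C blinfun_apply A x}"

definition Sigma_op :: "nat \<Rightarrow> enat \<Rightarrow> enat \<Rightarrow> ('h::complex_hilbert \<Rightarrow>\<^sub>L 'h) set"
  where "Sigma_op j n m = {A \<in> BH. op_type j n m UNIV (blinfun_apply A)}"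

definition sigma_fin :: "'h::complex_hilbert set \<Rightarrow> ('h \<Rightarrow> 'h) \<Rightarrow> complex set"
  where "sigma_fin D T = {z. hdim (op_range D (\<lambda>x. T x - z *\<^sub>C x)) \<noteq> \<infinity>}"

definition sigma_op ::
    "nat \<Rightarrow> enat \<Rightarrow> enat \<Rightarrow> 'h::complex_hilbert set \<Rightarrow> ('h \<Rightarrow> 'h) \<Rightarrow> complex set"
  where "sigma_op j n m D T = {z. op_type j n m D (\<lambda>x. T x - z *\<^sub>C x)}"

definition Sigma_family :: "'h::complex_hilbert set \<Rightarrow> ('h \<Rightarrow> 'h) \<Rightarrow> complex set set"
  where "Sigma_family D T = {sigma_fin D T} \<union> {sigma_op j n m D T |j n m. j \<in> {0, 1}}"


section \<open>Borel classes\<close>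

text \<open>The Borel hierarchy, indexed by the elements \<open>a\<close> of a well-order \<open>r\<close>; the ordinal belonging
  to \<open>a\<close> is the order type \<open>\<alpha>\<close> of its strict predecessors. The additive class of index \<open>\<alpha>\<close> is
  \<open>\<Sigma>\<^sup>0\<close> with index \<open>1 + \<alpha>\<close>: the open sets for \<open>\<alpha> = 0\<close>, the F-sigma sets for \<open>\<alpha> = 1\<close>, and in general
  countable unions of sets of lower multiplicative classes. The multiplicative classes consist of
  the complements.\<close>

inductive borel_additive :: "'a topology \<Rightarrow> 'i rel \<Rightarrow> 'i \<Rightarrow> 'a set \<Rightarrow> bool"
  for X :: "'a topology" and r :: "'i rel"
  where
    base: "a \<in> Field r \<Longrightarrow> underS r a = {} \<Longrightarrow> openin X S \<Longrightarrow> borel_additive X r a S"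
  | step: "a \<in> Field r \<Longrightarrow> underS r a \<noteq> {} \<Longrightarrow>
      (\<And>k::nat. F k \<subseteq> topspace X \<and> (\<exists>b\<in>underS r a. borel_additive X r b (topspace X - F k))) \<Longrightarrow>
      borel_additive X r a (\<Union>k. F k)"

definition borel_multiplicative :: "'a topology \<Rightarrow> 'i rel \<Rightarrow> 'i \<Rightarrow> 'a set \<Rightarrow> bool"
  where "borel_multiplicative X r a S \<longleftrightarrow> S \<subseteq> topspace X \<and> borel_additive X r a (topspace X - S)"

definition closed_inter_open_in :: "'a topology \<Rightarrow> 'a set \<Rightarrow> bool"
  where "closed_inter_open_in X S \<longleftrightarrow> (\<exists>C U. closedin X C \<and> openin X U \<and> S = C \<inter> U)"

definition fsigma_inter_gdelta_in :: "'a topology \<Rightarrow> 'a set \<Rightarrow> bool"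
  where "fsigma_inter_gdelta_in X S \<longleftrightarrow> (\<exists>F G. fsigma_in X F \<and> gdelta_in X G \<and> S = F \<inter> G)"

text \<open>Every countable ordinal is the order type of the predecessors of an element of some
  well-order on a subset of the natural numbers, so the first clause covers the whole hierarchy.
  The relation is directed: classes containing \<open>S\<close> in \<open>X\<close> also contain \<open>S'\<close> in \<open>Y\<close>, but not
  necessarily conversely.\<close>

definition same_borel_class :: "'a topology \<Rightarrow> 'a set \<Rightarrow> 'b topology \<Rightarrow> 'b set \<Rightarrow> bool"
  where "same_borel_class X S Y S' \<longleftrightarrow>
    (\<forall>(r :: nat rel) a. Well_order r \<and> a \<in> Field r \<longrightarrow>
      (borel_additive X r a S \<longrightarrow> borel_additive Y r a S') \<and>
      (borel_multiplicative X r a S \<longrightarrow> borel_multiplicative Y r a S')) \<and>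
    (closed_inter_open_in X S \<longrightarrow> closed_inter_open_in Y S') \<and>
    (fsigma_inter_gdelta_in X S \<longrightarrow> fsigma_inter_gdelta_in Y S')"

end

theory Submission
  imports Defs
begin

text \<open>The graph of \<open>T\<close> is a separable infinite-dimensional Hilbert space, so there is an isometric
  isomorphism \<open>U = (P, S)\<close> from \<open>H\<close> onto it. The bounded operators \<open>A z = S - z P\<close> depend
  continuously on \<open>z\<close>, have the same range as \<open>T - z\<close>, and \<open>P\<close> maps the kernel of \<open>A z\<close>
  isomorphically onto that of \<open>T - z\<close>. Hence each \<open>\<sigma>\<close>-set is the preimage of the corresponding
  \<open>\<Sigma>\<close>-set under the continuous map \<open>A\<close>, and Borel classes are stable under such preimages.

  For Borel measurability, \<open>dim R(A)\<^sup>\<bottom> \<le> n\<close> holds iff \<open>R(A)\<close> together with \<open>n\<close> vectors of a fixed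
  countable dense set spans a dense subspace, which is a Borel condition on \<open>A\<close>. Since \<open>N(A)\<close> is
  the orthogonal complement of the range of the adjoint, which depends continuously on \<open>A\<close>, the same
  applies to \<open>N(A)\<close>. Finally, \<open>R(A)\<close> is closed iff \<open>\<parallel>A x\<parallel> \<le> k \<parallel>A\<^sup>* A x\<parallel>\<close> for some \<open>k\<close> and
  all \<open>x\<close>, an F-sigma condition.\<close>

section \<open>Projections and adjoints in real Hilbert spaces\<close>

instance complex_hilbert \<subseteq> banach ..

lemma parallelogram_law:
  fixes a b :: "'a::real_inner"
  shows "(norm (a + b))\<^sup>2 + (norm (a - b))\<^sup>2 = 2 * (norm a)\<^sup>2 + 2 * (norm b)\<^sup>2"
  by (simp add: power2_norm_eq_inner algebra_simps inner_commute)

text \<open>The squared norm of \<open>w - t *\<^sub>R y\<close> is a quadratic in \<open>t\<close>.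
  At its minimiser \<open>inner w y / inner y y\<close> it lies below the squared norm of
  \<open>w\<close> by \<open>(inner w y)\<^sup>2 / inner y y\<close>, which minimality at
  \<open>t = 0\<close> forces to be zero.\<close>

lemma nearest_point_orthogonal:
  fixes w :: "'a::real_inner"
  assumes min: "\<And>t. norm w \<le> norm (w - t *\<^sub>R y)"
  shows "inner w y = 0"
proof (rule ccontr)
  assume "inner w y \<noteq> 0"
  then have y: "inner y y > 0" by auto
  define t where "t = inner w y / inner y y"
  have "(norm w)\<^sup>2 \<le> (norm (w - t *\<^sub>R y))\<^sup>2"
    using min[of t] by (simp add: power_mono)
  also have "\<dots> = (norm w)\<^sup>2 - 2 * t * inner w y + t * t * inner y y"
    by (simp add: power2_norm_eq_inner algebra_simps inner_commute)
  also have "t * t * inner y y = t * inner w y" using y by (simp add: t_def)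
  finally have "t * inner w y \<le> 0" by (simp add: algebra_simps)
  moreover have "t * inner w y = (inner w y)\<^sup>2 / inner y y" by (simp add: t_def power2_eq_square)
  ultimately show False using y \<open>inner w y \<noteq> 0\<close>
    by (auto simp: divide_le_0_iff)
qed

text \<open>Points of \<open>M\<close> whose distances to \<open>x\<close> approach
  \<open>infdist x M\<close> form a Cauchy sequence by the parallelogram law. The remainder at their
  limit is orthogonal to \<open>M\<close> because no shift along \<open>M\<close> shortens
  it.\<close>

lemma orthogonal_decomposition:
  fixes M :: "'a::{real_inner,banach} set"
  assumes "subspace M" "closed M"
  obtains m w where "x = m + w" "m \<in> M" "\<And>y. y \<in> M \<Longrightarrow> inner w y = 0"
proof -
  define d where "d = infdist x M"
  have ne: "M \<noteq> {}" using subspace_0[OF assms(1)] by auto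
  have d0: "d \<ge> 0" by (simp add: d_def infdist_nonneg)
  have dle: "d \<le> norm (x - y)" if "y \<in> M" for y
    using infdist_le[OF that, of x] by (simp add: d_def dist_norm)
  have "\<exists>y\<in>M. norm (x - y) < d + inverse (Suc n)" for n :: nat
  proof (rule ccontr)
    assume "\<not> ?thesis"
    then have "\<And>y. y \<in> M \<Longrightarrow> d + inverse (Suc n) \<le> dist x y"
      by (force simp: dist_norm)
    then have "d + inverse (Suc n) \<le> d"
      unfolding d_def infdist_notempty[OF ne] using ne by (intro cINF_greatest)
    then show False by simp
  qed
  then obtain m where mM: "\<And>n. m n \<in> M" and m: "\<And>n. norm (x - m n) < d + inverse (Suc n)"
    by metis
  have lim: "(\<lambda>n. norm (x - m n)) \<longlonglongrightarrow> d"
  proof (rule tendsto_sandwich[OF _ _ tendsto_const])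
    show "(\<lambda>n. d + inverse (real (Suc n))) \<longlonglongrightarrow> d"
      using tendsto_add[OF tendsto_const LIMSEQ_inverse_real_of_nat, of d] by simp
  qed (use dle mM m in \<open>auto intro!: always_eventually less_imp_le\<close>)
  \<comment> \<open>The midpoint of \<open>m i\<close> and \<open>m j\<close> lies in
    \<open>M\<close>, so \<open>(x - m i) + (x - m j)\<close> has norm at least
    \<open>2 * d\<close>; the parallelogram law turns this into a bound on the difference.\<close>
  have par: "(norm (m i - m j))\<^sup>2 \<le> 2 * (norm (x - m i))\<^sup>2 + 2 * (norm (x - m j))\<^sup>2 - 4 * d\<^sup>2" for i j
  proof -
    have "(1/2) *\<^sub>R (m i + m j) \<in> M"
      using mM assms(1) by (simp add: subspace_add subspace_scale)
    from dle[OF this] have "2 * d \<le> 2 * norm (x - (1/2) *\<^sub>R (m i + m j))" by simp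
    also have "\<dots> = norm (2 *\<^sub>R (x - (1/2) *\<^sub>R (m i + m j)))" by simp
    also have "2 *\<^sub>R (x - (1/2) *\<^sub>R (m i + m j)) = (x - m i) + (x - m j)"
      by (simp add: algebra_simps scaleR_2)
    finally have "(2 * d)\<^sup>2 \<le> (norm ((x - m i) + (x - m j)))\<^sup>2"
      using d0 by (intro power_mono) auto
    moreover have "norm ((x - m i) - (x - m j)) = norm (m i - m j)"
      by (simp add: norm_minus_commute)
    ultimately show ?thesis using parallelogram_law[of "x - m i" "x - m j"] by simp
  qed
  have "Cauchy m"
  proof (rule metric_CauchyI)
    fix e :: real assume e: "e > 0"
    have "(\<lambda>n. (norm (x - m n))\<^sup>2) \<longlonglongrightarrow> d\<^sup>2" using lim by (intro tendsto_intros)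
    \<comment> \<open>The margin \<open>e\<^sup>2 / 4\<close> makes the right-hand side of
      \<open>par\<close> smaller than \<open>e\<^sup>2\<close>.\<close>
    then have "eventually (\<lambda>n. (norm (x - m n))\<^sup>2 < d\<^sup>2 + e\<^sup>2 / 4) sequentially"
      using e by (intro order_tendstoD) auto
    then obtain N where N: "\<And>n. n \<ge> N \<Longrightarrow> (norm (x - m n))\<^sup>2 < d\<^sup>2 + e\<^sup>2 / 4"
      by (auto simp: eventually_sequentially)
    have "dist (m i) (m j) < e" if "i \<ge> N" "j \<ge> N" for i j
    proof -
      have "(norm (m i - m j))\<^sup>2 < e\<^sup>2"
        using par[of i j] N[OF that(1)] N[OF that(2)] by linarith
      then show ?thesis using e by (simp add: dist_norm power_less_imp_less_base)
    qed
    then show "\<exists>N. \<forall>i\<ge>N. \<forall>j\<ge>N. dist (m i) (m j) < e" by blast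
  qed
  then obtain p where p: "m \<longlonglongrightarrow> p" using Cauchy_convergent convergent_def by blast
  have pM: "p \<in> M" using closed_sequentially[OF assms(2)] mM p by blast
  have "(\<lambda>n. norm (x - m n)) \<longlonglongrightarrow> norm (x - p)" using p by (intro tendsto_intros)
  then have dp: "norm (x - p) = d" using lim LIMSEQ_unique by blast
  have "inner (x - p) y = 0" if "y \<in> M" for y
  proof (rule nearest_point_orthogonal)
    fix t
    have "p + t *\<^sub>R y \<in> M" using pM that assms(1) by (simp add: subspace_add subspace_scale)
    from dle[OF this] show "norm (x - p) \<le> norm (x - p - t *\<^sub>R y)" by (simp add: dp algebra_simps)
  qed
  then show thesis using that[of p "x - p"] pM by simp
qed

lemma orthogonal_closure:
  fixes M :: "'a::real_inner set"
  assumes "\<And>y. y \<in> M \<Longrightarrow> inner w y = 0" "y \<in> closure M"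
  shows "inner w y = 0"
proof -
  have "closed {y. inner w y = 0}" by (intro closed_Collect_eq continuous_intros)
  then show ?thesis using closure_minimal[of M "{y. inner w y = 0}"] assms by auto
qed

lemma subspace_closure:
  fixes M :: "'a::real_normed_vector set"
  assumes "subspace M"
  shows "subspace (closure M)"
proof -
  have M: "x + y \<in> M" "c *\<^sub>R x \<in> M" "0 \<in> M" if "x \<in> M" "y \<in> M" for x y c
    using assms that by (auto simp: subspace_def)
  have "x + y \<in> closure M" if xy: "x \<in> closure M" "y \<in> closure M" for x y
  proof -
    obtain s t where st: "\<And>n. s n \<in> M" "s \<longlonglongrightarrow> x" "\<And>n. t n \<in> M" "t \<longlonglongrightarrow> y"
      using xy by (auto simp: closure_sequential)
    then have "(\<lambda>n. s n + t n) \<longlonglongrightarrow> x + y" by (intro tendsto_intros)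
    then show ?thesis using st(1,3) M(1) unfolding closure_sequential by (intro exI[of _ "\<lambda>n. s n + t n"]) auto
  qed
  moreover have "c *\<^sub>R x \<in> closure M" if x: "x \<in> closure M" for x c
  proof -
    obtain s where st: "\<And>n. s n \<in> M" "s \<longlonglongrightarrow> x" using x by (auto simp: closure_sequential)
    then have "(\<lambda>n. c *\<^sub>R s n) \<longlonglongrightarrow> c *\<^sub>R x" by (intro tendsto_intros)
    then show ?thesis using st(1) M(2) unfolding closure_sequential by (intro exI[of _ "\<lambda>n. c *\<^sub>R s n"]) auto
  qed
  moreover have "0 \<in> closure M" using subspace_0[OF assms] closure_subset by blast
  ultimately show ?thesis by (auto simp: subspace_def)
qed

text \<open>When \<open>x\<close> is split along the closure of \<open>M\<close>, the orthogonal
  remainder vanishes by assumption, so \<open>x\<close> itself lies in the closure.\<close>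

lemma subspace_dense_iff:
  fixes M :: "'a::{real_inner,banach} set"
  assumes "subspace M"
  shows "closure M = UNIV \<longleftrightarrow> (\<forall>w. (\<forall>y\<in>M. inner w y = 0) \<longrightarrow> w = 0)"
proof
  assume "closure M = UNIV"
  then show "\<forall>w. (\<forall>y\<in>M. inner w y = 0) \<longrightarrow> w = 0"
    using orthogonal_closure[of M w w for w] by auto
next
  assume *: "\<forall>w. (\<forall>y\<in>M. inner w y = 0) \<longrightarrow> w = 0"
  have "x \<in> closure M" for x
  proof -
    obtain m w where "x = m + w" "m \<in> closure M" "\<And>y. y \<in> closure M \<Longrightarrow> inner w y = 0"
      using orthogonal_decomposition[OF subspace_closure[OF assms] closed_closure, of x] by blast
    moreover from this have "w = 0" using * closure_subset by blast
    ultimately show ?thesis by simp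
  qed
  then show "closure M = UNIV" by auto
qed

section \<open>Riesz representation and adjoints\<close>

text \<open>A single vector \<open>w\<close> orthogonal to the kernel determines a nonzero
  \<open>f\<close>: the vector \<open>x - (f x / f w) *\<^sub>R w\<close> lies in the kernel, and
  its orthogonality to \<open>w\<close> recovers \<open>f x\<close>.\<close>

lemma riesz_representation:
  fixes f :: "'a::{real_inner,banach} \<Rightarrow> real"
  assumes "bounded_linear f"
  obtains v where "\<And>x. f x = inner x v"
proof (cases "\<forall>x. f x = 0")
  case True
  then show ?thesis using that[of 0] by simp
next
  case False
  interpret f: bounded_linear f by fact
  let ?K = "{x. f x = 0}"
  obtain x0 where x0: "f x0 \<noteq> 0" using False by auto
  have "subspace ?K" by (auto simp: subspace_def f.add f.scaleR)
  moreover have "closed ?K" by (intro closed_Collect_eq f.continuous_on continuous_intros)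
  ultimately obtain m w where mw: "x0 = m + w" "m \<in> ?K" "\<And>y. y \<in> ?K \<Longrightarrow> inner w y = 0"
    using orthogonal_decomposition[of ?K x0] by blast
  have fw: "f w \<noteq> 0" using x0 mw by (simp add: f.add)
  then have w: "inner w w \<noteq> 0" using f.zero by auto
  have "f x = inner x ((f w / inner w w) *\<^sub>R w)" for x
  proof -
    have "x - (f x / f w) *\<^sub>R w \<in> ?K" using fw by (simp add: f.diff f.scaleR)
    from mw(3)[OF this] have "inner w x = f x / f w * inner w w" by (simp add: algebra_simps)
    then show ?thesis using fw w by (simp add: inner_commute field_simps)
  qed
  then show ?thesis using that by blast
qed

text \<open>The adjoint for the real inner product; \<open>inner_hadjoint\<close> and
  \<open>hadjoint_unique\<close> show that the choice exists and is unique. For complex-linear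
  operators it agrees with the complex adjoint, since the real part determines the complex inner
  product.\<close>

definition hadjoint :: "('a::{real_inner,banach} \<Rightarrow>\<^sub>L 'b::real_inner) \<Rightarrow> 'b \<Rightarrow> 'a"
  where "hadjoint A y = (SOME v. \<forall>x. inner (blinfun_apply A x) y = inner x v)"

lemma inner_hadjoint: "inner (blinfun_apply A x) y = inner x (hadjoint A y)"
proof -
  have "bounded_linear (\<lambda>x. inner (blinfun_apply A x) y)"
    by (intro bounded_linear_intros)
  then obtain v where "\<And>x. inner (blinfun_apply A x) y = inner x v"
    using riesz_representation by blast
  then have "\<exists>v. \<forall>x. inner (blinfun_apply A x) y = inner x v" by blast
  from someI_ex[OF this] show ?thesis unfolding hadjoint_def by (rule spec)
qed

lemma hadjoint_unique: "hadjoint A y = v" if "\<And>x. inner (blinfun_apply A x) y = inner x v"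
proof -
  have "\<forall>x. inner x (hadjoint A y) = inner x v" using that by (simp add: inner_hadjoint)
  then show ?thesis by (simp only: vector_eq_ldot)
qed

lemma hadjoint_add: "hadjoint A (x + y) = hadjoint A x + hadjoint A y"
  by (rule hadjoint_unique) (simp add: inner_add_right inner_hadjoint)

lemma hadjoint_scaleR: "hadjoint A (r *\<^sub>R x) = r *\<^sub>R hadjoint A x"
  by (rule hadjoint_unique) (simp add: inner_hadjoint)

text \<open>The difference \<open>v\<close> is tested against itself and Cauchy-Schwarz applied.
  Comparing two operators at once yields both boundedness of the adjoint (\<open>B = 0\<close>) and
  its continuity in the operator.\<close>

lemma norm_hadjoint_diff_le: "norm (hadjoint A y - hadjoint B y) \<le> norm (A - B) * norm y"
proof -
  define v where "v = hadjoint A y - hadjoint B y"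
  have "norm v * norm v = inner (blinfun_apply (A - B) v) y"
    by (simp add: v_def inner_diff_right inner_diff_left blinfun.diff_left inner_hadjoint
        flip: power2_norm_eq_inner power2_eq_square)
       (simp add: power2_norm_eq_inner inner_diff_right inner_diff_left)
  also have "\<dots> \<le> norm (blinfun_apply (A - B) v) * norm y" by (rule norm_cauchy_schwarz)
  also have "\<dots> \<le> (norm (A - B) * norm v) * norm y" by (intro mult_right_mono norm_blinfun) auto
  finally have "norm v * norm v \<le> norm v * (norm (A - B) * norm y)" by (simp add: algebra_simps)
  then show ?thesis
    by (cases "norm v = 0") (auto simp flip: v_def)
qed

lemma norm_hadjoint_le:
  fixes A :: "'a::{real_inner,banach} \<Rightarrow>\<^sub>L 'b::real_inner"
  shows "norm (hadjoint A y) \<le> norm A * norm y"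
proof -
  have "hadjoint (0 :: 'a \<Rightarrow>\<^sub>L 'b) y = 0" by (rule hadjoint_unique) simp
  then show ?thesis using norm_hadjoint_diff_le[of A y 0] by simp
qed

lemma bounded_linear_hadjoint:
  fixes A :: "'a::{real_inner,banach} \<Rightarrow>\<^sub>L 'b::real_inner"
  shows "bounded_linear (hadjoint A)"
  by (rule bounded_linear_intro[where K = "norm A"])
    (auto simp: hadjoint_add hadjoint_scaleR norm_hadjoint_le mult.commute[of "norm _" "norm A"])

lemma hadjoint_diff:
  fixes A :: "'a::{real_inner,banach} \<Rightarrow>\<^sub>L 'b::real_inner"
  shows "hadjoint A (x - y) = hadjoint A x - hadjoint A y"
  by (rule hadjoint_unique) (simp add: inner_diff_right inner_hadjoint)

text \<open>This makes the inequality in the closed-range criterion a closed condition on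
  \<open>A\<close>.\<close>

lemma continuous_on_hadjoint_apply:
  fixes S :: "('a::{real_inner,banach} \<Rightarrow>\<^sub>L 'b::real_inner) set"
  shows "continuous_on S (\<lambda>A. hadjoint A (blinfun_apply A x))"
  unfolding continuous_on_def
proof
  fix B :: "'a \<Rightarrow>\<^sub>L 'b"
  let ?b = "\<lambda>A. norm (A - B) * norm (blinfun_apply A x) + norm B * norm (blinfun_apply A x - blinfun_apply B x)"
  have "((\<lambda>A. hadjoint A (blinfun_apply A x) - hadjoint B (blinfun_apply B x)) \<longlongrightarrow> 0) (at B within S)"
  proof (rule Lim_null_comparison)
    \<comment> \<open>The first summand changes only the operator, the second only the argument;
      they match the two terms of \<open>?b\<close>.\<close>
    have eq: "hadjoint A (blinfun_apply A x) - hadjoint B (blinfun_apply B x) =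
        (hadjoint A (blinfun_apply A x) - hadjoint B (blinfun_apply A x)) +
        hadjoint B (blinfun_apply A x - blinfun_apply B x)" for A
      by (simp add: hadjoint_diff)
    have "norm (hadjoint A (blinfun_apply A x) - hadjoint B (blinfun_apply B x)) \<le> ?b A" for A
      by (subst eq) (rule norm_triangle_mono[OF norm_hadjoint_diff_le norm_hadjoint_le])
    then show "\<forall>\<^sub>F A in at B within S. norm (hadjoint A (blinfun_apply A x) - hadjoint B (blinfun_apply B x)) \<le> ?b A"
      by simp
    have "(?b \<longlongrightarrow> norm (B - B) * norm (blinfun_apply B x) + norm B * norm (blinfun_apply B x - blinfun_apply B x))
        (at B within S)"
      by (intro tendsto_intros)
    then show "(?b \<longlongrightarrow> 0) (at B within S)" by simp
  qed
  then show "((\<lambda>A. hadjoint A (blinfun_apply A x)) \<longlongrightarrow> hadjoint B (blinfun_apply B x)) (at B within S)"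
    by (rule Lim_null[THEN iffD2])
qed

lemma continuous_on_hadjoint: "continuous_on S (\<lambda>A. hadjoint A y)"
proof (rule lipschitz_on_continuous_on)
  show "(norm y)-lipschitz_on S (\<lambda>A. hadjoint A y)"
    by (rule lipschitz_onI) (auto simp: dist_norm mult.commute[of "norm y"] norm_hadjoint_diff_le)
qed

text \<open>Gliding hump: along an unbounded sequence \<open>y\<close> the partial sums of a series of steps of
  length \<open>(1/3)^n\<close> in the directions \<open>\<plusminus>y n\<close> can be chosen so that no later step undoes the
  growth of the inner product with \<open>y n\<close>.\<close>

lemma weakly_bounded_imp_bounded:
  fixes Y :: "'a::{real_inner,banach} set"
  assumes "\<And>w. \<exists>C. \<forall>y\<in>Y. \<bar>inner y w\<bar> \<le> C"
  obtains C where "\<And>y. y \<in> Y \<Longrightarrow> norm y \<le> C"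
proof (rule ccontr)
  assume "\<not> thesis"
  then have "\<exists>y\<in>Y. norm y > C" for C using that by (meson not_less)
  \<comment> \<open>The growth \<open>4 ^ n\<close> outpaces the step length
    \<open>(1/3) ^ n\<close>: their product \<open>(4/3) ^ n\<close> is unbounded, which contradicts
    the bound \<open>C\<close> at the end.\<close>
  then have "\<exists>y. y \<in> Y \<and> norm y > 4 ^ n" for n :: nat by blast
  then obtain y where yY: "\<And>n::nat. y n \<in> Y" and y: "\<And>n. norm (y n) > 4 ^ n" by metis
  have step: "\<exists>w'. norm (w' - w) \<le> (1/3) ^ n \<and> \<bar>inner (y n) w'\<bar> \<ge> (1/3) ^ n * norm (y n)" for w n
  proof -
    have "(0::real) \<le> 4 ^ n" by simp
    with y[of n] have y0: "norm (y n) > 0" by linarith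
    define u where "u = ((1/3) ^ n / norm (y n)) *\<^sub>R y n"
    have nu: "norm u = (1/3) ^ n" using y0 by (simp add: u_def)
    have iu: "inner (y n) u = (1/3) ^ n * norm (y n)"
      using y0 by (simp add: u_def dot_square_norm power2_eq_square)
    have "inner (y n) (w + u) - inner (y n) (w - u) = 2 * inner (y n) u"
      by (simp add: algebra_simps)
    then consider "\<bar>inner (y n) (w + u)\<bar> \<ge> inner (y n) u" | "\<bar>inner (y n) (w - u)\<bar> \<ge> inner (y n) u"
      by linarith
    then show ?thesis
    proof cases
      case 1
      then show ?thesis using nu iu by (intro exI[of _ "w + u"]) simp
    next
      case 2
      then show ?thesis using nu iu by (intro exI[of _ "w - u"]) simp
    qed
  qed
  define g where "g n w = (SOME w'. norm (w' - w) \<le> (1/3) ^ n \<and>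
    \<bar>inner (y n) w'\<bar> \<ge> (1/3) ^ n * norm (y n))" for n w
  have g: "norm (g n w - w) \<le> (1/3) ^ n" "\<bar>inner (y n) (g n w)\<bar> \<ge> (1/3) ^ n * norm (y n)" for n w
    using someI_ex[OF step[of w n]] by (auto simp: g_def)
  define w where "w = rec_nat 0 (\<lambda>n v. g n v)"
  have w_Suc: "w (Suc n) = g n (w n)" for n by (simp add: w_def)
  have ws: "norm (w (Suc n) - w n) \<le> (1/3) ^ n" for n by (simp add: w_Suc g)
  have dist: "norm (w (n + k) - w n) \<le> 3/2 * (1/3) ^ n * (1 - (1/3) ^ k)" for n k
  proof (induction k)
    case (Suc k)
    have "norm (w (n + Suc k) - w n) \<le> norm (w (Suc (n + k)) - w (n + k)) + norm (w (n + k) - w n)"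
      using norm_triangle_ineq[of "w (Suc (n + k)) - w (n + k)" "w (n + k) - w n"] by simp
    also have "\<dots> \<le> (1/3) ^ (n + k) + 3/2 * (1/3) ^ n * (1 - (1/3) ^ k)"
      using ws[of "n + k"] Suc by linarith
    also have "\<dots> = 3/2 * (1/3) ^ n * (1 - (1/3) ^ Suc k)"
      by (simp add: power_add field_simps)
    finally show ?case .
  qed simp
  have dist': "norm (w (n + k) - w n) \<le> 3/2 * (1/3) ^ n" for n k
    by (rule order_trans[OF dist]) (simp add: mult_left_le)
  have "summable (\<lambda>n. w (Suc n) - w n)"
    using ws by (intro summable_comparison_test'[OF summable_geometric[of "1/3::real"]]) auto
  then have "convergent (\<lambda>n. \<Sum>i<n. w (Suc i) - w i)" by (simp add: summable_iff_convergent)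
  then have "convergent (\<lambda>n. w n - w 0)" by (simp add: sum_lessThan_telescope)
  then obtain l where l: "w \<longlonglongrightarrow> l" unfolding convergent_diff_const_right_iff convergent_def ..
  have lw: "norm (l - w n) \<le> 3/2 * (1/3) ^ n" for n
  proof (rule tendsto_upperbound)
    show "(\<lambda>k. norm (w (k + n) - w n)) \<longlonglongrightarrow> norm (l - w n)"
      using l by (intro tendsto_intros LIMSEQ_ignore_initial_segment)
    show "\<forall>\<^sub>F k in sequentially. norm (w (k + n) - w n) \<le> 3/2 * (1/3) ^ n"
      using dist'[of n] by (simp add: add.commute)
  qed simp
  obtain C where C: "\<And>y. y \<in> Y \<Longrightarrow> \<bar>inner y l\<bar> \<le> C" using assms by blast
  have "(1/2) * (4/3) ^ n \<le> C" for n
  proof -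
    \<comment> \<open>The steps after step \<open>n\<close> add up to at most
      \<open>3/2 * (1/3) ^ Suc n\<close>, half of \<open>(1/3) ^ n\<close>, so at least half of the
      growth obtained at step \<open>n\<close> survives in the limit.\<close>
    have "\<bar>inner (y n) (l - w (Suc n))\<bar> \<le> norm (y n) * (3/2 * (1/3) ^ Suc n)"
      by (rule order_trans[OF Cauchy_Schwarz_ineq2]) (intro mult_left_mono lw norm_ge_zero)
    also have "\<dots> = (1/2) * ((1/3) ^ n * norm (y n))" by simp
    finally have "\<bar>inner (y n) l - inner (y n) (w (Suc n))\<bar> \<le> (1/2) * ((1/3) ^ n * norm (y n))"
      by (simp add: inner_diff_right)
    moreover have "\<bar>inner (y n) (w (Suc n))\<bar> \<ge> (1/3) ^ n * norm (y n)" by (simp add: w_Suc g)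
    ultimately have "\<bar>inner (y n) l\<bar> \<ge> (1/2) * (1/3) ^ n * norm (y n)"
      by linarith
    moreover have "(1/2) * (1/3) ^ n * norm (y n) \<ge> (1/2) * (1/3) ^ n * 4 ^ n"
      using y[of n] by (intro mult_left_mono) auto
    moreover have "(1/3) ^ n * 4 ^ n = (4/3 :: real) ^ n" by (simp flip: power_mult_distrib)
    ultimately show ?thesis using C[OF yY[of n]] by (simp add: mult.assoc)
  qed
  moreover obtain n where "(4/3::real) ^ n > 2 * C" using real_arch_pow[of "4/3"] by auto
  ultimately have "(1/2) * (4/3) ^ n \<le> C" "(4/3::real) ^ n > 2 * C" by auto
  then show False by simp
qed

section \<open>A quantitative criterion for closed range\<close>

lemma closed_range_iff:
  fixes A :: "'a::{real_inner,banach} \<Rightarrow>\<^sub>L 'b::{real_inner,banach}"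
  shows "closed (range A) \<longleftrightarrow> (\<exists>k::nat. \<forall>x. norm (A x) \<le> real k * norm (hadjoint A (A x)))"
proof
  assume cl: "closed (range A)"
  have sub: "subspace (range A)"
    by (intro linear_subspace_image bounded_linear.linear blinfun.bounded_linear_right subspace_UNIV)
  let ?Y = "{y \<in> range A. norm (hadjoint A y) \<le> 1}"
  have "\<exists>C. \<forall>y\<in>?Y. \<bar>inner y w\<bar> \<le> C" for w
  proof -
    obtain r s where rs: "w = r + s" "r \<in> range A" "\<And>y. y \<in> range A \<Longrightarrow> inner s y = 0"
      using orthogonal_decomposition[OF sub cl, of w] by blast
    obtain x where x: "r = A x" using rs(2) by auto
    have "\<bar>inner y w\<bar> \<le> norm x" if "y \<in> ?Y" for y
    proof -
      have "inner y w = inner (A x) y"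
        using rs(3)[of y] that by (simp add: rs(1) x inner_add_right inner_commute)
      also have "\<dots> = inner x (hadjoint A y)" by (rule inner_hadjoint)
      finally have "\<bar>inner y w\<bar> \<le> norm x * norm (hadjoint A y)" by (simp add: Cauchy_Schwarz_ineq2)
      also have "\<dots> \<le> norm x * 1" using that by (intro mult_left_mono) auto
      finally show ?thesis by simp
    qed
    then show ?thesis by blast
  qed
  from weakly_bounded_imp_bounded[OF this]
  obtain C where C: "\<And>y. y \<in> ?Y \<Longrightarrow> norm y \<le> C" by metis
  obtain k :: nat where k: "C \<le> k" using real_arch_simple by blast
  have "norm (A x) \<le> real k * norm (hadjoint A (A x))" for x
  proof (cases "hadjoint A (A x) = 0")
    case True
    then have "inner (A x) (A x) = 0" by (simp add: inner_hadjoint)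
    then show ?thesis by simp
  next
    case False
    \<comment> \<open>Dividing \<open>x\<close> by \<open>t\<close> gives the adjoint of the image
      norm 1, which places that image in \<open>?Y\<close>.\<close>
    define t where "t = norm (hadjoint A (A x))"
    have t: "t > 0" using False by (simp add: t_def)
    have "blinfun_apply A ((1/t) *\<^sub>R x) \<in> ?Y"
    proof (intro CollectI conjI rangeI)
      show "norm (hadjoint A (blinfun_apply A ((1/t) *\<^sub>R x))) \<le> 1"
        using t by (simp add: blinfun.scaleR_right hadjoint_scaleR flip: t_def)
    qed
    from C[OF this] have "norm (A x) / t \<le> C" using t by (simp add: blinfun.scaleR_right)
    with k have "norm (A x) / t \<le> k" by linarith
    then show ?thesis using t by (simp add: field_simps flip: t_def)
  qed
  then show "\<exists>k::nat. \<forall>x. norm (A x) \<le> real k * norm (hadjoint A (A x))" by blast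
next
  assume "\<exists>k::nat. \<forall>x. norm (A x) \<le> real k * norm (hadjoint A (A x))"
  then obtain k :: nat where k: "\<And>x. norm (A x) \<le> real k * norm (hadjoint A (A x))" by blast
  interpret A': bounded_linear "hadjoint A" by (rule bounded_linear_hadjoint)
  let ?V = "closure (range A)"
  \<comment> \<open>Adding 1 keeps the constant positive when \<open>k = 0\<close>, so that
    \<open>1 / K\<^sup>2\<close> is a genuine lower bound for \<open>B\<close>.\<close>
  define K where "K = real k + 1"
  have K: "K > 0" by (simp add: K_def)
  have sub: "subspace ?V"
    by (intro subspace_closure linear_subspace_image bounded_linear.linear
        blinfun.bounded_linear_right subspace_UNIV)
  have bd: "norm y \<le> K * norm (hadjoint A y)" if "y \<in> ?V" for y
  proof -
    have "closed {y. norm y \<le> K * norm (hadjoint A y)}"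
      by (intro closed_Collect_le continuous_intros A'.continuous_on)
    moreover have "norm (A x) \<le> K * norm (hadjoint A (A x))" for x
      using k[of x] by (simp add: K_def distrib_right add_increasing2)
    then have "range A \<subseteq> {y. norm y \<le> K * norm (hadjoint A y)}" by auto
    ultimately show ?thesis using closure_minimal that by blast
  qed
  define B where "B = (\<lambda>y. A (hadjoint A y))"
  have blB: "bounded_linear B"
    unfolding B_def by (intro bounded_linear_intros bounded_linear_hadjoint)
  then interpret B: bounded_linear B .
  have Bin: "inner (B y) y = (norm (hadjoint A y))\<^sup>2" for y
    by (simp add: B_def inner_hadjoint power2_norm_eq_inner)
  have lowB: "(1 / K\<^sup>2) * norm y \<le> norm (B y)" if "y \<in> ?V" for y
  proof (cases "y = 0")
    case False
    have "(norm y)\<^sup>2 \<le> (K * norm (hadjoint A y))\<^sup>2" using bd[OF that] by (intro power_mono) auto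
    also have "\<dots> = K\<^sup>2 * inner (B y) y" by (simp add: Bin power_mult_distrib)
    also have "\<dots> \<le> K\<^sup>2 * (norm (B y) * norm y)" by (intro mult_left_mono norm_cauchy_schwarz) auto
    finally have "norm y * norm y \<le> norm y * (K\<^sup>2 * norm (B y))"
      by (simp add: power2_eq_square algebra_simps)
    then show ?thesis using False K by (simp add: field_simps)
  qed simp
  have "closed (B ` ?V)"
    using complete_isometric_image[OF _ sub blB, of "1 / K\<^sup>2"] lowB K
    by (simp add: complete_eq_closed)
  moreover have "subspace (B ` ?V)" by (rule linear_subspace_image[OF bounded_linear.linear[OF blB] sub])
  ultimately have dec: "\<exists>m u. v = m + u \<and> m \<in> B ` ?V \<and> (\<forall>y\<in>B ` ?V. inner u y = 0)" for v
    by (meson orthogonal_decomposition)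
  have BR: "B ` ?V \<subseteq> range A" by (auto simp: B_def)
  have "?V \<subseteq> range A"
  proof
    fix v assume v: "v \<in> ?V"
    obtain m u where mu: "v = m + u" "m \<in> B ` ?V" "\<And>y. y \<in> B ` ?V \<Longrightarrow> inner u y = 0"
      using dec by metis
    have "m \<in> ?V" using mu BR closure_subset by blast
    then have uV: "u \<in> ?V" using subspace_diff[OF sub v, of m] mu(1) by simp
    then have "inner (B u) u = 0" using mu(3)[of "B u"] by (simp add: inner_commute)
    then have "hadjoint A u = 0" using Bin[of u] by simp
    then have "u = 0" using bd[OF uV] by simp
    then show "v \<in> range A" using mu BR by auto
  qed
  then show "closed (range A)" by (simp only: closure_subset_eq)
qed


section \<open>Orthonormal bases of complex Hilbert spaces\<close>

lemma scaleC_zero_left [simp]: "0 *\<^sub>C x = (0::'a::complex_vector)"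
  and scaleC_zero_right [simp]: "c *\<^sub>C (0::'a) = 0"
  and scaleC_diff_left: "(c - d) *\<^sub>C x = c *\<^sub>C x - d *\<^sub>C x"
  and scaleC_diff_right: "c *\<^sub>C (x - y) = c *\<^sub>C x - c *\<^sub>C y"
  by (simp_all add: complex_vector.scale_left_diff_distrib
      complex_vector.scale_right_diff_distrib)

lemma scaleC_scaleR: "c *\<^sub>C (r *\<^sub>R x) = r *\<^sub>R (c *\<^sub>C x)"
  by (simp add: scaleR_scaleC scaleC_scaleC mult.commute)

lemma cinner_add_right: "cinner x (y + z) = cinner x y + cinner x z"
  by (metis cinner_commute cinner_add_left complex_cnj_add)

lemma cinner_scaleC_right: "cinner x (a *\<^sub>C y) = cnj a * cinner x y"
  by (metis cinner_commute cinner_scaleC_left complex_cnj_mult complex_cnj_cnj)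

lemma cinner_zero_left [simp]: "cinner 0 y = 0"
  using cinner_scaleC_left[of 0 0 y] by simp

lemma cinner_zero_right [simp]: "cinner x 0 = 0"
  using cinner_scaleC_right[of x 0 0] by simp

lemma cinner_diff_left: "cinner (x - y) z = cinner x z - cinner y z"
  using cinner_add_left[of "x - y" y z] by simp

lemma cinner_sum_left: "cinner (\<Sum>k\<in>F. f k) y = (\<Sum>k\<in>F. cinner (f k) y)"
  by (induction F rule: infinite_finite_induct) (auto simp: cinner_add_left)

text \<open>The complex inner product is recovered from the real one, which is how the real theory
  above carries over to complex subspaces.\<close>

lemma cinner_eq_inner: "cinner x y = Complex (inner x y) (inner x (\<i> *\<^sub>C y))"
  by (rule complex_eqI) (simp_all add: inner_eq_Re_cinner cinner_scaleC_right)

lemma cinner_self: "cinner x x = complex_of_real ((norm x)\<^sup>2)"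
proof (rule complex_eqI)
  show "Re (cinner x x) = Re (complex_of_real ((norm x)\<^sup>2))"
    by (simp add: power2_norm_eq_inner inner_eq_Re_cinner)
  show "Im (cinner x x) = Im (complex_of_real ((norm x)\<^sup>2))"
    using arg_cong[OF cinner_commute[of x x], of Im] by simp
qed

lemma cinner_self_eq_zero_iff [simp]: "cinner x x = 0 \<longleftrightarrow> x = 0"
  by (simp add: cinner_self)

lemma cinner_eq_zero_commute: "cinner x y = 0 \<longleftrightarrow> cinner y x = 0"
  by (metis cinner_commute complex_cnj_zero_iff)

lemma norm_scaleC [simp]: "norm (c *\<^sub>C x) = cmod c * norm (x::'a::complex_hilbert)"
proof -
  have "complex_of_real ((norm (c *\<^sub>C x))\<^sup>2) = complex_of_real ((cmod c * norm x)\<^sup>2)"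
    unfolding cinner_self[symmetric] cinner_scaleC_left cinner_scaleC_right
    using complex_norm_square[of c] by (simp add: cinner_self power_mult_distrib)
  then show ?thesis by (simp only: of_real_eq_iff) (simp add: power2_eq_iff_nonneg)
qed

lemma bounded_linear_scaleC_right: "bounded_linear (\<lambda>x::'a::complex_hilbert. c *\<^sub>C x)"
  by (rule bounded_linear_intro[where K = "cmod c"])
    (auto simp: scaleC_add_right scaleC_scaleR mult.commute)

lemma bounded_linear_cinner_left: "bounded_linear (\<lambda>x. cinner x y)"
proof -
  have "bounded_linear (\<lambda>x. complex_of_real (inner x y) + \<i> * complex_of_real (inner x (\<i> *\<^sub>C y)))"
    by (intro bounded_linear_add bounded_linear_const_mult bounded_linear_inner_left_comp
        bounded_linear_ident bounded_linear_compose[OF bounded_linear_of_real])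
  then show ?thesis by (simp add: cinner_eq_inner complex_eq_iff[abs_def] Complex_eq)
qed

lemma csubspace_imp_subspace: "csubspace M \<Longrightarrow> subspace M"
  by (auto simp: complex_vector.subspace_def subspace_def scaleR_scaleC)

text \<open>With \<open>y\<close> a complex subspace also contains \<open>\<i> *\<^sub>C y\<close>,
  and real orthogonality to the latter is the vanishing of the imaginary part of
  \<open>cinner w y\<close>.\<close>

lemma corthogonal_complement_csubspace:
  assumes "csubspace M"
  shows "corthogonal_complement M = {w. \<forall>y\<in>M. inner w y = 0}"
  using assms
  by (auto simp: corthogonal_complement_def complex_vector.subspace_def cinner_eq_inner
      zero_complex.ctr complex_eq_iff)

lemma csubspace_corthogonal_complement: "csubspace (corthogonal_complement M)"
  by (auto simp: corthogonal_complement_def complex_vector.subspace_def cinner_add_left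
      cinner_scaleC_left)

lemma cinner_zero_on_cspan:
  assumes "\<And>b. b \<in> B \<Longrightarrow> cinner w b = 0" "y \<in> cspan B"
  shows "cinner w y = 0"
  using assms(2)
  by (induction rule: complex_vector.span_induct_alt)
    (auto simp: assms(1) cinner_add_right cinner_scaleC_right)

text \<open>A Gram-Schmidt step at each insertion: \<open>v = b - p\<close> is the part of the new
  vector \<open>b\<close> orthogonal to the old span, and the projection of \<open>x\<close> is
  corrected along \<open>v\<close> only.\<close>

lemma finite_cspan_decomposition:
  assumes "finite B"
  obtains m where "m \<in> cspan B" "\<And>b. b \<in> B \<Longrightarrow> cinner (x - m) b = 0"
  using assms
proof (induction B arbitrary: x thesis rule: finite_induct)
  case empty
  then show ?case by (meson complex_vector.span_zero empty_iff)
next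
  case (insert b B)
  obtain p where p: "p \<in> cspan B" "\<And>a. a \<in> B \<Longrightarrow> cinner (b - p) a = 0" using insert.IH by blast
  obtain m where m: "m \<in> cspan B" "\<And>a. a \<in> B \<Longrightarrow> cinner (x - m) a = 0" using insert.IH by blast
  define v where "v = b - p"
  \<comment> \<open>For \<open>v = 0\<close> the new vector already lies in the old span, and no
    correction is made.\<close>
  define t where "t = (if v = 0 then 0 else cinner (x - m) v / cinner v v)"
  have sub: "cspan B \<subseteq> cspan (insert b B)" by (intro complex_vector.span_mono) auto
  have "v \<in> cspan (insert b B)"
    unfolding v_def using p(1) sub
    by (intro complex_vector.span_diff) (auto intro: complex_vector.span_base)
  then have mt: "m + t *\<^sub>C v \<in> cspan (insert b B)"
    using m(1) sub by (intro complex_vector.span_add complex_vector.span_scale) auto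
  have ortB: "cinner (x - (m + t *\<^sub>C v)) a = 0" if "a \<in> B" for a
  proof -
    have "cinner (x - (m + t *\<^sub>C v)) a = cinner (x - m) a - t * cinner v a"
      by (simp add: cinner_diff_left cinner_add_left cinner_scaleC_left)
    then show ?thesis using m(2) p(2) that by (simp add: v_def)
  qed
  have "cinner (x - (m + t *\<^sub>C v)) v = cinner (x - m) v - t * cinner v v"
    by (simp add: cinner_diff_left cinner_add_left cinner_scaleC_left)
  also have "\<dots> = 0" by (simp add: t_def)
  finally have "cinner (x - (m + t *\<^sub>C v)) (v + p) = 0"
    using cinner_zero_on_cspan[OF ortB p(1)] by (simp add: cinner_add_right)
  then have "cinner (x - (m + t *\<^sub>C v)) b = 0" by (simp add: v_def)
  with ortB mt show ?case by (intro insert.prems[of "m + t *\<^sub>C v"]) auto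
qed

text \<open>For \<open>x\<close> in the closure, the remainder \<open>x - m\<close> lies in the
  closure and is orthogonal to it, so it is zero.\<close>

lemma closed_cspan_finite:
  fixes B :: "'a::complex_hilbert set"
  assumes "finite B"
  shows "closed (cspan B)"
proof -
  have "x \<in> cspan B" if x: "x \<in> closure (cspan B)" for x
  proof -
    obtain m where m: "m \<in> cspan B" "\<And>b. b \<in> B \<Longrightarrow> cinner (x - m) b = 0"
      using finite_cspan_decomposition[OF assms] by blast
    have "subspace (closure (cspan B))"
      by (intro subspace_closure csubspace_imp_subspace complex_vector.subspace_span)
    then have "x - m \<in> closure (cspan B)" using x m(1) closure_subset by (blast intro: subspace_diff)
    moreover have "inner (x - m) y = 0" if "y \<in> cspan B" for y
      using cinner_zero_on_cspan[OF m(2) that] by (simp add: inner_eq_Re_cinner)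
    ultimately have "inner (x - m) (x - m) = 0" using orthogonal_closure by blast
    then show ?thesis using m(1) by simp
  qed
  then show ?thesis by (metis closure_subset_eq subsetI)
qed

section \<open>Orthonormal sequences, bases and expansions\<close>

definition orthonormal_sequence :: "(nat \<Rightarrow> 'a::complex_hilbert) \<Rightarrow> bool"
  where "orthonormal_sequence e \<longleftrightarrow> (\<forall>i j. cinner (e i) (e j) = (if i = j then 1 else 0))"

lemma orthonormal_sequenceD:
  "orthonormal_sequence e \<Longrightarrow> cinner (e i) (e j) = (if i = j then 1 else 0)"
  by (simp add: orthonormal_sequence_def)

lemma cinner_orthonormal_sum:
  assumes "orthonormal_sequence e" "finite F"
  shows "cinner (\<Sum>k\<in>F. c k *\<^sub>C e k) (e j) = (if j \<in> F then c j else 0)"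
  using assms(2)
  by (simp add: cinner_sum_left cinner_scaleC_left orthonormal_sequenceD[OF assms(1)] if_distrib
      cong: if_cong)

lemma norm_orthonormal_sum:
  assumes "orthonormal_sequence e" "finite F"
  shows "(norm (\<Sum>k\<in>F. c k *\<^sub>C e k))\<^sup>2 = (\<Sum>k\<in>F. (cmod (c k))\<^sup>2)"
  using assms(2)
proof (induction F rule: finite_induct)
  case (insert j F)
  define s where "s = (\<Sum>k\<in>F. c k *\<^sub>C e k)"
  have "cinner s (e j) = 0"
    using insert by (simp add: s_def cinner_orthonormal_sum[OF assms(1)])
  then have "inner s (c j *\<^sub>C e j) = 0" by (simp add: inner_eq_Re_cinner cinner_scaleC_right)
  then have "(norm (c j *\<^sub>C e j + s))\<^sup>2 = (norm (c j *\<^sub>C e j))\<^sup>2 + (norm s)\<^sup>2"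
    by (intro norm_add_Pythagorean) (simp add: orthogonal_def inner_commute)
  moreover have "(norm (e j))\<^sup>2 = 1"
    using cinner_self[of "e j"] orthonormal_sequenceD[OF assms(1), of j j]
    by (metis of_real_eq_1_iff)
  ultimately show ?case using insert by (simp add: s_def power_mult_distrib)
qed simp

lemma bessel_inequality:
  assumes "orthonormal_sequence e"
  shows "(\<Sum>k<n. (cmod (cinner x (e k)))\<^sup>2) \<le> (norm x)\<^sup>2"
proof -
  define s where "s = (\<Sum>k<n. cinner x (e k) *\<^sub>C e k)"
  have "cinner (x - s) (e j) = 0" if "j < n" for j
    using that by (simp add: s_def cinner_diff_left cinner_orthonormal_sum[OF assms])
  then have "cinner (e j) (x - s) = 0" if "j < n" for j
    using that cinner_eq_zero_commute by blast
  then have "cinner s (x - s) = 0"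
    by (simp add: s_def cinner_sum_left cinner_scaleC_left)
  then have "inner s (x - s) = 0" by (simp add: inner_eq_Re_cinner)
  then have "(norm (s + (x - s)))\<^sup>2 = (norm s)\<^sup>2 + (norm (x - s))\<^sup>2"
    by (intro norm_add_Pythagorean) (simp add: orthogonal_def)
  then have "(norm s)\<^sup>2 \<le> (norm x)\<^sup>2" by simp
  then show ?thesis by (simp add: s_def norm_orthonormal_sum[OF assms])
qed

lemma summable_bessel:
  assumes "orthonormal_sequence e"
  shows "summable (\<lambda>k. (cmod (cinner x (e k)))\<^sup>2)"
  by (rule summableI_nonneg_bounded[where x = "(norm x)\<^sup>2"]) (auto simp: bessel_inequality[OF assms])

lemma summable_orthonormal:
  assumes "orthonormal_sequence e" "summable (\<lambda>k. (cmod (c k))\<^sup>2)"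
  shows "summable (\<lambda>k. c k *\<^sub>C e k)"
  unfolding summable_Cauchy
proof (intro allI impI)
  fix r :: real assume r: "r > 0"
  then obtain N where N: "\<And>m n. m \<ge> N \<Longrightarrow> norm (\<Sum>k=m..<n. (cmod (c k))\<^sup>2) < r\<^sup>2"
    using assms(2) unfolding summable_Cauchy by (metis zero_less_power)
  have "norm (\<Sum>k=m..<n. c k *\<^sub>C e k) < r" if "m \<ge> N" for m n
  proof -
    have "(norm (\<Sum>k=m..<n. c k *\<^sub>C e k))\<^sup>2 < r\<^sup>2"
      using N[OF that, of n] by (simp add: norm_orthonormal_sum[OF assms(1)])
    then show ?thesis using r by (simp add: power_less_imp_less_base)
  qed
  then show "\<exists>N. \<forall>m\<ge>N. \<forall>n. norm (\<Sum>k=m..<n. c k *\<^sub>C e k) < r" by blast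
qed

lemma cinner_orthonormal_suminf:
  assumes "orthonormal_sequence e" "summable (\<lambda>k. c k *\<^sub>C e k)"
  shows "cinner (\<Sum>k. c k *\<^sub>C e k) (e j) = c j"
proof -
  have "(\<lambda>k. cinner (c k *\<^sub>C e k) (e j)) sums cinner (\<Sum>k. c k *\<^sub>C e k) (e j)"
    using bounded_linear.sums[OF bounded_linear_cinner_left summable_sums[OF assms(2)]] .
  moreover have "(\<lambda>k. cinner (c k *\<^sub>C e k) (e j)) = (\<lambda>k. if k = j then c k else 0)"
    by (auto simp: cinner_scaleC_left orthonormal_sequenceD[OF assms(1)])
  ultimately show ?thesis using sums_single[of j c] sums_unique2 by metis
qed

lemma norm_orthonormal_suminf:
  assumes "orthonormal_sequence e" "summable (\<lambda>k. c k *\<^sub>C e k)"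
  shows "(norm (\<Sum>k. c k *\<^sub>C e k))\<^sup>2 = (\<Sum>k. (cmod (c k))\<^sup>2)"
proof -
  have "(\<lambda>n. (norm (\<Sum>k<n. c k *\<^sub>C e k))\<^sup>2) \<longlonglongrightarrow> (norm (\<Sum>k. c k *\<^sub>C e k))\<^sup>2"
    by (intro tendsto_intros summable_LIMSEQ assms)
  then have "(\<lambda>k. (cmod (c k))\<^sup>2) sums (norm (\<Sum>k. c k *\<^sub>C e k))\<^sup>2"
    by (simp add: sums_def norm_orthonormal_sum[OF assms(1)])
  then show ?thesis by (rule sums_unique)
qed

text \<open>Maximality inside \<open>S\<close> stands in for density of the span; for closed
  \<open>S\<close> it yields the series expansion. Indexing by the naturals restricts to countably
  infinite bases.\<close>

definition orthonormal_basis_of :: "'a::complex_hilbert set \<Rightarrow> (nat \<Rightarrow> 'a) \<Rightarrow> bool"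
  where "orthonormal_basis_of S e \<longleftrightarrow> orthonormal_sequence e \<and> range e \<subseteq> S \<and>
    (\<forall>x\<in>S. (\<forall>k. cinner x (e k) = 0) \<longrightarrow> x = 0)"

lemma suminf_mem_closed_csubspace:
  fixes S :: "'a::complex_hilbert set"
  assumes "csubspace S" "closed S" "range e \<subseteq> S" "summable (\<lambda>k. c k *\<^sub>C e k)"
  shows "(\<Sum>k. c k *\<^sub>C e k) \<in> S"
proof (rule closed_sequentially[OF assms(2) _ summable_LIMSEQ[OF assms(4)]])
  show "(\<Sum>k<n. c k *\<^sub>C e k) \<in> S" for n
    using assms(3)
    by (intro complex_vector.subspace_sum[OF assms(1)] complex_vector.subspace_scale[OF assms(1)]) auto
qed

text \<open>The difference between \<open>x\<close> and its series stays in the closed subspace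
  \<open>S\<close> and is orthogonal to every \<open>e j\<close>, so maximality makes it
  zero.\<close>

lemma orthonormal_basis_expansion:
  assumes "orthonormal_basis_of S e" "csubspace S" "closed S" "x \<in> S"
  shows "x = (\<Sum>k. cinner x (e k) *\<^sub>C e k)"
proof -
  have e: "orthonormal_sequence e" "range e \<subseteq> S"
    and max: "\<And>x. x \<in> S \<Longrightarrow> (\<And>k. cinner x (e k) = 0) \<Longrightarrow> x = 0"
    using assms(1) by (auto simp: orthonormal_basis_of_def)
  note sm = summable_orthonormal[OF e(1) summable_bessel[OF e(1)], of x]
  have "x - (\<Sum>k. cinner x (e k) *\<^sub>C e k) = 0"
  proof (rule max)
    show "x - (\<Sum>k. cinner x (e k) *\<^sub>C e k) \<in> S"
      using suminf_mem_closed_csubspace[OF assms(2,3) e(2) sm]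
      by (intro complex_vector.subspace_diff[OF assms(2)] assms(4))
    show "cinner (x - (\<Sum>k. cinner x (e k) *\<^sub>C e k)) (e j) = 0" for j
      by (simp add: cinner_diff_left cinner_orthonormal_suminf[OF e(1) sm])
  qed
  then show ?thesis by simp
qed

text \<open>Zorn's lemma gives a maximal orthonormal set \<open>M\<close>. Infinite dimension makes
  it infinite and separability makes it countable, so it can be enumerated bijectively by the
  naturals.\<close>

lemma orthonormal_basis_exists:
  fixes S Q :: "'a::complex_hilbert set"
  assumes S: "csubspace S" and Q: "countable Q" "closure Q = UNIV"
    and inf: "\<And>B. finite B \<Longrightarrow> \<not> S \<subseteq> cspan B"
  obtains e where "orthonormal_basis_of S e"
proof -
  define ON where "ON = {B. B \<subseteq> S \<and> (\<forall>x\<in>B. \<forall>y\<in>B. cinner x y = (if x = y then 1 else 0))}"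
  have "\<exists>M\<in>ON. \<forall>X\<in>ON. M \<subseteq> X \<longrightarrow> X = M"
  proof (rule subset_Zorn_nonempty)
    show "ON \<noteq> {}" by (auto simp: ON_def)
    fix C assume C: "C \<noteq> {}" "subset.chain ON C"
    have "cinner x y = (if x = y then 1 else 0)" if xy: "x \<in> \<Union>C" "y \<in> \<Union>C" for x y
    proof -
      obtain X Y where XY: "X \<in> C" "x \<in> X" "Y \<in> C" "y \<in> Y" using xy by auto
      then have "X \<subseteq> Y \<or> Y \<subseteq> X" using C(2) by (auto simp: subset_chain_def)
      then obtain Z where "Z \<in> C" "x \<in> Z" "y \<in> Z" using XY by blast
      then show ?thesis using C(2) by (auto simp: subset_chain_def ON_def)
    qed
    moreover have "\<Union>C \<subseteq> S" using C(2) by (auto simp: subset_chain_def ON_def)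
    ultimately show "\<Union>C \<in> ON" by (simp add: ON_def)
  qed
  then obtain M where M: "M \<in> ON" and Mmax: "\<And>X. X \<in> ON \<Longrightarrow> M \<subseteq> X \<Longrightarrow> X = M" by blast
  have MS: "M \<subseteq> S" and orth: "\<And>x y. x \<in> M \<Longrightarrow> y \<in> M \<Longrightarrow> cinner x y = (if x = y then 1 else 0)"
    using M by (auto simp: ON_def)
  have max: "x = 0" if x: "x \<in> S" and perp: "\<And>b. b \<in> M \<Longrightarrow> cinner x b = 0" for x
  proof (rule ccontr)
    assume x0: "x \<noteq> 0"
    define u where "u = complex_of_real (1 / norm x) *\<^sub>C x"
    have "cinner u u = complex_of_real ((norm u)\<^sup>2)" by (rule cinner_self)
    also have "norm u = 1" using x0 by (simp add: u_def norm_divide)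
    finally have "cinner u u = 1" by simp
    moreover have ub: "cinner u b = 0" if "b \<in> M" for b
      using perp[OF that] by (simp add: u_def cinner_scaleC_left)
    moreover from this have "cinner b u = 0" if "b \<in> M" for b
      using that cinner_eq_zero_commute by blast
    moreover have "u \<in> S" using x by (simp add: u_def complex_vector.subspace_scale[OF S])
    moreover have "u \<notin> M" using ub[of u] \<open>cinner u u = 1\<close> by auto
    ultimately have "insert u M \<in> ON" using MS orth unfolding ON_def by auto
    then show False using Mmax \<open>u \<notin> M\<close> by blast
  qed
  \<comment> \<open>If \<open>M\<close> were finite, subtracting from a vector of \<open>S\<close>
    its projection onto \<open>cspan M\<close> would leave a nonzero vector of \<open>S\<close>
    orthogonal to \<open>M\<close>.\<close>
  have "infinite M"
  proof
    assume fin: "finite M"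
    obtain x where x: "x \<in> S" "x \<notin> cspan M" using inf[OF fin] by auto
    obtain m where m: "m \<in> cspan M" "\<And>b. b \<in> M \<Longrightarrow> cinner (x - m) b = 0"
      using finite_cspan_decomposition[OF fin] by blast
    have "m \<in> S" using m(1) complex_vector.span_minimal[OF MS S] by auto
    then have "x - m = 0" using m(2) x(1) by (intro max complex_vector.subspace_diff[OF S])
    then show False using x m by simp
  qed
  moreover have "countable M"
  proof -
    \<comment> \<open>Distinct orthonormal vectors have squared distance 2, but two vectors
      approximated by the same \<open>q\<close> within 1/2 are less than 1 apart; hence
      \<open>q\<close> is injective on \<open>M\<close>.\<close>
    have "\<exists>q\<in>Q. dist q b < 1/2" for b
      using Q(2) closure_approachable[of b Q] by (metis UNIV_I half_gt_zero_iff zero_less_one)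
    then obtain q where q: "\<And>b. q b \<in> Q" "\<And>b. dist (q b) b < 1/2" by metis
    have "inj_on q M"
    proof (rule inj_onI, rule ccontr)
      fix a b assume ab: "a \<in> M" "b \<in> M" "q a = q b" "a \<noteq> b"
      have "dist a b < 1"
        using q(2)[of a] q(2)[of b] dist_triangle2[of a b "q a"] ab(3) by (simp add: dist_commute)
      then have "(dist a b)\<^sup>2 < 1" by (simp add: power_less_one_iff abs_square_less_1)
      moreover have "inner a a = 1" "inner b b = 1" "inner a b = 0"
        using orth[OF ab(1,1)] orth[OF ab(2,2)] orth[OF ab(1,2)] ab(4)
        by (simp_all add: inner_eq_Re_cinner)
      then have "(dist a b)\<^sup>2 = 2"
        by (simp add: dist_norm power2_norm_eq_inner inner_diff_left inner_diff_right inner_commute)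
      ultimately show False by simp
    qed
    moreover have "countable (q ` M)" using Q(1) q(1) by (metis countable_subset image_subsetI)
    ultimately show ?thesis using countable_image_inj_on by blast
  qed
  ultimately have bij: "bij_betw (from_nat_into M) UNIV M" by (rule bij_betw_from_nat_into[rotated])
  have "orthonormal_basis_of S (from_nat_into M)"
    unfolding orthonormal_basis_of_def orthonormal_sequence_def
  proof (intro conjI allI ballI impI)
    show "cinner (from_nat_into M i) (from_nat_into M j) = (if i = j then 1 else 0)" for i j
      using bij orth by (metis bij_betw_def injD rangeI)
    show "range (from_nat_into M) \<subseteq> S" using bij MS by (simp add: bij_betw_def)
    fix x assume "x \<in> S" "\<forall>k. cinner x (from_nat_into M k) = 0"
    moreover have "\<exists>k. b = from_nat_into M k" if "b \<in> M" for b
      using bij that by (auto simp: bij_betw_def)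
    ultimately show "x = 0" using max by metis
  qed
  then show thesis using that by blast
qed

text \<open>\<open>U\<close> carries the coefficients along \<open>e\<close> over to
  \<open>f\<close>. Bessel makes the series converge, and equality of both norms with the same
  coefficient sum makes \<open>U\<close> isometric.\<close>

lemma isometric_isomorphism_exists:
  fixes e :: "nat \<Rightarrow> 'a::complex_hilbert" and f :: "nat \<Rightarrow> 'b::complex_hilbert"
  assumes e: "orthonormal_basis_of UNIV e"
    and f: "orthonormal_basis_of S f" and S: "csubspace S" "closed S"
  obtains U :: "'a \<Rightarrow> 'b" where "bounded_linear U" "\<And>c x. U (c *\<^sub>C x) = c *\<^sub>C U x"
    "\<And>x. norm (U x) = norm x" "range U = S"
proof -
  have e': "orthonormal_sequence e" and f': "orthonormal_sequence f" "range f \<subseteq> S"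
    using e f by (auto simp: orthonormal_basis_of_def)
  define U where "U x = (\<Sum>k. cinner x (e k) *\<^sub>C f k)" for x
  note smU = summable_orthonormal[OF f'(1) summable_bessel[OF e']]
  note smE = summable_orthonormal[OF e' summable_bessel[OF e']]
  have add: "U (x + y) = U x + U y" for x y
    unfolding U_def suminf_add[OF smU smU] by (simp add: cinner_add_left scaleC_add_left)
  have scale: "U (c *\<^sub>C x) = c *\<^sub>C U x" for c x
    unfolding U_def bounded_linear.suminf[OF bounded_linear_scaleC_right smU]
    by (simp add: cinner_scaleC_left scaleC_scaleC)
  have nrm: "norm (U x) = norm x" for x
  proof -
    have "(norm (U x))\<^sup>2 = (\<Sum>k. (cmod (cinner x (e k)))\<^sup>2)"
      unfolding U_def by (rule norm_orthonormal_suminf[OF f'(1) smU])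
    also have "\<dots> = (norm (\<Sum>k. cinner x (e k) *\<^sub>C e k))\<^sup>2"
      by (rule norm_orthonormal_suminf[OF e' smE, symmetric])
    also have "(\<Sum>k. cinner x (e k) *\<^sub>C e k) = x"
      using orthonormal_basis_expansion[OF e, of x] by simp
    finally show ?thesis by (simp add: power2_eq_iff_nonneg)
  qed
  have bl: "bounded_linear U"
    by (rule bounded_linear_intro[where K = 1]) (auto simp: add scaleR_scaleC scale nrm)
  have "range U = S"
  proof (intro subset_antisym subsetI)
    fix y assume "y \<in> range U"
    then show "y \<in> S" using suminf_mem_closed_csubspace[OF S f'(2) smU] by (auto simp: U_def)
  next
    fix y assume y: "y \<in> S"
    note sm = summable_orthonormal[OF e' summable_bessel[OF f'(1)], of y]
    \<comment> \<open>The preimage of \<open>y\<close> is built along \<open>e\<close> from the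
      coefficients of \<open>y\<close> along \<open>f\<close>.\<close>
    have "U (\<Sum>k. cinner y (f k) *\<^sub>C e k) = (\<Sum>k. cinner y (f k) *\<^sub>C f k)"
      by (simp add: U_def cinner_orthonormal_suminf[OF e' sm])
    also have "\<dots> = y" using orthonormal_basis_expansion[OF f S y] by simp
    finally show "y \<in> range U" by (metis rangeI)
  qed
  then show thesis by (rule that[OF bl scale nrm])
qed


section \<open>Dimensions and Borel measurability\<close>

text \<open>Spanning sets of bounded size are easier to transport than bases; together with
  \<open>enat_eqI_le\<close> this reduces equalities of dimensions to moving such sets.\<close>

lemma hdim_le_iff:
  "hdim V \<le> enat n \<longleftrightarrow> (\<exists>B. finite B \<and> card B \<le> n \<and> V \<subseteq> cspan B)"
proof
  assume le: "hdim V \<le> enat n"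
  then have fin: "\<exists>B. finite B \<and> V \<subseteq> cspan B" by (auto simp: hdim_def split: if_splits)
  then obtain C where C: "finite C" "V \<subseteq> cspan C" by blast
  obtain B where B: "B \<subseteq> V" "\<not> complex_vector.dependent B" "V \<subseteq> cspan B" "card B = cdim V"
    using complex_vector.basis_exists by blast
  have "finite B" using complex_vector.independent_span_bound[OF C(1) B(2)] B(1) C(2) by blast
  then show "\<exists>B. finite B \<and> card B \<le> n \<and> V \<subseteq> cspan B"
    using B le fin by (auto simp: hdim_def)
next
  assume "\<exists>B. finite B \<and> card B \<le> n \<and> V \<subseteq> cspan B"
  then obtain B where B: "finite B" "card B \<le> n" "V \<subseteq> cspan B" by blast
  then have "cdim V \<le> n" using complex_vector.dim_le_card[of V B] by linarith
  then show "hdim V \<le> enat n" using B by (auto simp: hdim_def)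
qed

lemma hdim_eq_infinity_iff: "hdim V = \<infinity> \<longleftrightarrow> (\<forall>B. finite B \<longrightarrow> \<not> V \<subseteq> cspan B)"
  by (auto simp: hdim_def)

lemma enat_eqI_le: "(\<And>n. a \<le> enat n \<longleftrightarrow> b \<le> enat n) \<Longrightarrow> a = b"
  by (metis enat_ord_simps(3) not_enat_eq order_antisym order_refl)

text \<open>A finite span is closed, so it contains \<open>V\<close> exactly when it contains the
  closure. This identifies infinite dimension of the closed range with lying outside
  \<open>sigma_fin\<close>.\<close>

lemma hdim_closure:
  fixes V :: "'a::complex_hilbert set"
  shows "hdim (closure V) = hdim V"
proof (rule enat_eqI_le)
  show "hdim (closure V) \<le> enat n \<longleftrightarrow> hdim V \<le> enat n" for n
    unfolding hdim_le_iff
    by (metis closure_minimal closed_cspan_finite closure_subset order_trans)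
qed

lemma cspan_image:
  fixes P :: "'a::complex_vector \<Rightarrow> 'b::complex_vector"
  assumes "\<And>x y. P (x + y) = P x + P y" "\<And>c x. P (c *\<^sub>C x) = c *\<^sub>C P x"
  shows "P ` cspan B = cspan (P ` B)"
proof -
  interpret P: Vector_Spaces.linear "scaleC :: complex \<Rightarrow> 'a \<Rightarrow> 'a" "scaleC :: complex \<Rightarrow> 'b \<Rightarrow> 'b" P
    by unfold_locales (simp_all add: assms)
  show ?thesis unfolding cspan_def by (rule P.span_image[symmetric])
qed

lemma hdim_linear_image:
  fixes P :: "'a::complex_vector \<Rightarrow> 'b::complex_vector"
  assumes add: "\<And>x y. P (x + y) = P x + P y" and scale: "\<And>c x. P (c *\<^sub>C x) = c *\<^sub>C P x"
    and inj: "inj P" and V: "csubspace V"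
  shows "hdim (P ` V) = hdim V"
proof (rule enat_eqI_le)
  fix n
  show "hdim (P ` V) \<le> enat n \<longleftrightarrow> hdim V \<le> enat n"
  proof
    assume "hdim V \<le> enat n"
    then obtain B where B: "finite B" "card B \<le> n" "V \<subseteq> cspan B" unfolding hdim_le_iff by blast
    then have "P ` V \<subseteq> cspan (P ` B)" by (simp add: image_mono flip: cspan_image[OF add scale])
    moreover have "card (P ` B) \<le> n" using B card_image_le[of B P] by linarith
    ultimately show "hdim (P ` V) \<le> enat n" unfolding hdim_le_iff using B(1) by blast
  next
    assume le: "hdim (P ` V) \<le> enat n"
    then obtain C where C: "finite C" "card C \<le> n" "P ` V \<subseteq> cspan C" unfolding hdim_le_iff by blast
    \<comment> \<open>\<open>C\<close> may leave the image of \<open>V\<close>; a maximal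
      independent set inside the image can be pulled back along \<open>P\<close>.\<close>
    obtain B where B: "B \<subseteq> P ` V" "\<not> complex_vector.dependent B" "P ` V \<subseteq> cspan B"
      by (rule complex_vector.maximal_independent_subset)
    have cB: "finite B \<and> card B \<le> card C"
      using B(1) C(3) by (intro complex_vector.independent_span_bound[OF C(1) B(2)]) blast
    obtain B0 where B0: "B0 \<subseteq> V" "B = P ` B0" using B(1) by (meson subset_imageE)
    have "V \<subseteq> cspan B0"
    proof
      fix v assume "v \<in> V"
      then have "P v \<in> P ` cspan B0"
        using B(3) unfolding B0(2) cspan_image[OF add scale] by blast
      then show "v \<in> cspan B0" using inj by (simp add: inj_image_mem_iff)
    qed
    moreover have "finite B0" "card B0 = card B"
      using cB inj_on_subset[OF inj subset_UNIV] unfolding B0(2)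
      by (auto simp: finite_image_iff card_image)
    ultimately show "hdim V \<le> enat n" unfolding hdim_le_iff using cB C(2) by (metis order_trans)
  qed
qed

section \<open>Dimension measured by separating vectors\<close>

text \<open>Each condition \<open>cinner x f = 0\<close> lowers the dimension by at most one: either
  it already holds on \<open>V\<close>, or a single \<open>v\<close> violating it spans
  \<open>V\<close> modulo the smaller subspace \<open>W\<close>.\<close>

lemma span_bound_of_separating:
  assumes "finite F" "csubspace V" "V \<inter> corthogonal_complement F = {0}"
  shows "\<exists>B. finite B \<and> card B \<le> card F \<and> V \<subseteq> cspan B"
  using assms
proof (induction F arbitrary: V rule: finite_induct)
  case empty
  then show ?case by (intro exI[of _ "{}"]) (auto simp: corthogonal_complement_def)
next
  case (insert f F)
  define W where "W = V \<inter> corthogonal_complement {f}"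
  have W: "csubspace W"
    unfolding W_def
    by (intro complex_vector.subspace_inter insert.prems csubspace_corthogonal_complement)
  have "W \<inter> corthogonal_complement F = {0}"
    using insert.prems(2) by (auto simp: W_def corthogonal_complement_def)
  from insert.IH[OF W this]
  obtain B where B: "finite B" "card B \<le> card F" "W \<subseteq> cspan B" by blast
  show ?case
  proof (cases "V \<subseteq> W")
    case True
    then show ?thesis using B insert.hyps by (intro exI[of _ B]) auto
  next
    case False
    then obtain v where v: "v \<in> V" "cinner v f \<noteq> 0" by (auto simp: W_def corthogonal_complement_def)
    have "x \<in> cspan (insert v B)" if x: "x \<in> V" for x
    proof -
      have "x - (cinner x f / cinner v f) *\<^sub>C v \<in> W"
        using v x insert.prems(1)
        by (auto simp: W_def corthogonal_complement_def cinner_diff_left cinner_scaleC_left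
            intro!: complex_vector.subspace_diff complex_vector.subspace_scale)
      then show ?thesis using B(3) complex_vector.span_breakdown_eq by blast
    qed
    moreover have "card (insert v B) \<le> card (insert f F)"
      using B insert.hyps by (simp add: card_insert_if)
    ultimately show ?thesis using B(1) by (intro exI[of _ "insert v B"]) auto
  qed
qed

text \<open>Since no nonzero vector is orthogonal to all of \<open>E\<close>, some \<open>f\<close>
  in \<open>E\<close> detects a given nonzero \<open>v\<close> in \<open>V\<close>; cutting
  \<open>V\<close> by \<open>f\<close> lowers the dimension, and induction supplies the other
  vectors.\<close>

lemma separating_of_span_bound:
  fixes V :: "'a::complex_hilbert set"
  assumes "csubspace V" "finite B" "card B \<le> n" "V \<subseteq> cspan B"
    and E: "corthogonal_complement E = {0}"
  shows "\<exists>F. finite F \<and> F \<subseteq> E \<and> card F \<le> n \<and> V \<inter> corthogonal_complement F = {0}"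
  using assms(1-4)
proof (induction n arbitrary: V B)
  case 0
  then have "V = {0}" using complex_vector.subspace_0[of V] by auto
  then show ?case by (intro exI[of _ "{}"]) (auto simp: corthogonal_complement_def)
next
  case (Suc n)
  show ?case
  proof (cases "V = {0}")
    case True
    then show ?thesis by (intro exI[of _ "{}"]) (auto simp: corthogonal_complement_def)
  next
    case False
    then obtain v where v: "v \<in> V" "v \<noteq> 0" using complex_vector.subspace_0[OF Suc.prems(1)] by blast
    then obtain f where f: "f \<in> E" "cinner v f \<noteq> 0"
      using E by (auto simp: corthogonal_complement_def)
    define W where "W = V \<inter> corthogonal_complement {f}"
    have W: "csubspace W"
      unfolding W_def
      by (intro complex_vector.subspace_inter Suc.prems csubspace_corthogonal_complement)
    obtain C where C: "C \<subseteq> W" "\<not> complex_vector.dependent C" "W \<subseteq> cspan C"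
      by (rule complex_vector.maximal_independent_subset)
    have CW: "cspan C \<subseteq> W" using complex_vector.span_minimal[OF C(1) W] .
    \<comment> \<open>As \<open>v\<close> lies outside \<open>W\<close>, adjoining it to the basis
      \<open>C\<close> stays independent, so \<open>C\<close> has at most \<open>n\<close>
      elements.\<close>
    have vC: "v \<notin> cspan C" using CW f by (auto simp: W_def corthogonal_complement_def)
    then have "v \<notin> C" using complex_vector.span_base by blast
    have "\<not> complex_vector.dependent (insert v C)"
      by (rule complex_vector.independent_insertI[OF vC C(2)])
    moreover have "insert v C \<subseteq> cspan B" using v C(1) Suc.prems(4) by (auto simp: W_def)
    ultimately have "finite (insert v C) \<and> card (insert v C) \<le> card B"
      by (intro complex_vector.independent_span_bound Suc.prems)
    then have "finite C" "card C \<le> n" using \<open>v \<notin> C\<close> Suc.prems(3) by auto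
    from Suc.IH[OF W this C(3)] obtain F where
      F: "finite F" "F \<subseteq> E" "card F \<le> n" "W \<inter> corthogonal_complement F = {0}" by blast
    have "V \<inter> corthogonal_complement (insert f F) = {0}"
      using F(4) by (auto simp: W_def corthogonal_complement_def)
    then show ?thesis using F f(1) by (intro exI[of _ "insert f F"]) (auto simp: card_insert_if)
  qed
qed

text \<open>For countable \<open>E\<close> only countably many finite sets \<open>F\<close> occur,
  which makes a dimension bound a countable union of conditions.\<close>

lemma hdim_le_iff_separating:
  fixes V :: "'a::complex_hilbert set"
  assumes "csubspace V" "corthogonal_complement E = {0}"
  shows "hdim V \<le> enat n \<longleftrightarrow>
    (\<exists>F. finite F \<and> F \<subseteq> E \<and> card F \<le> n \<and> V \<inter> corthogonal_complement F = {0})"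
proof
  assume "hdim V \<le> enat n"
  then show "\<exists>F. finite F \<and> F \<subseteq> E \<and> card F \<le> n \<and> V \<inter> corthogonal_complement F = {0}"
    unfolding hdim_le_iff using separating_of_span_bound[OF assms(1) _ _ _ assms(2)] by blast
next
  assume "\<exists>F. finite F \<and> F \<subseteq> E \<and> card F \<le> n \<and> V \<inter> corthogonal_complement F = {0}"
  then obtain F where F: "finite F" "card F \<le> n" "V \<inter> corthogonal_complement F = {0}" by blast
  from span_bound_of_separating[OF F(1) assms(1) F(3)]
  obtain B where "finite B" "card B \<le> card F" "V \<subseteq> cspan B" by blast
  then show "hdim V \<le> enat n"
    unfolding hdim_le_iff using F(2) by (intro exI[of _ B]) simp
qed

section \<open>Borel measurability of dimension conditions\<close>

lemma corthogonal_complement_dense: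
  fixes E :: "'a::complex_hilbert set"
  assumes "closure E = UNIV"
  shows "corthogonal_complement E = {0}"
proof -
  have "w = 0" if "\<And>y. y \<in> E \<Longrightarrow> cinner w y = 0" for w
  proof -
    have "inner w y = 0" if "y \<in> E" for y
      using \<open>\<And>y. y \<in> E \<Longrightarrow> cinner w y = 0\<close>[OF that] by (simp add: inner_eq_Re_cinner)
    then have "inner w w = 0" using orthogonal_closure[of E w w] assms by blast
    then show ?thesis by simp
  qed
  then show ?thesis by (auto simp: corthogonal_complement_def)
qed

text \<open>A subspace \<open>M\<close> and a finite set \<open>F\<close> have only \<open>0\<close> as a common orthogonal vector iff
  \<open>M + cspan F\<close> is dense, and by continuity density is a countable intersection of open conditions
  on the parameter.\<close>

lemma borel_hdim_complement_le:
  fixes g :: "'x::topological_space \<Rightarrow> 'y \<Rightarrow> 'h::complex_hilbert"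
  assumes E: "countable E" "closure E = (UNIV :: 'h set)"
    and X: "X \<in> sets borel"
    and cont: "\<And>y. continuous_on X (\<lambda>A. g A y)"
    and sub: "\<And>A. A \<in> X \<Longrightarrow> csubspace (range (g A))"
  shows "{A \<in> X. hdim (corthogonal_complement (range (g A))) \<le> enat n} \<in> sets borel"
proof -
  \<comment> \<open>Here \<open>range (g A) + cspan F\<close> comes within
    \<open>1 / (k + 1)\<close> of \<open>q\<close>. For fixed \<open>y\<close> and \<open>v\<close>
    this is relatively open in \<open>A\<close>, and arbitrary unions over \<open>y\<close> and
    \<open>v\<close> keep it so.\<close>
  define Y where "Y F q k = {A \<in> X. \<exists>y. \<exists>v\<in>cspan F. dist (g A y + v) q < inverse (Suc k)}"
    for F q and k :: nat
  have "openin (top_of_set X) (Y F q k)" for F q k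
  proof -
    have "Y F q k = (\<Union>y. \<Union>v\<in>cspan F. X \<inter> (\<lambda>A. g A y) -` {u. dist (u + v) q < inverse (Suc k)})"
      by (auto simp: Y_def)
    moreover have "openin (top_of_set X) (X \<inter> (\<lambda>A. g A y) -` {u. dist (u + v) q < inverse (Suc k)})" for y v
      by (intro continuous_openin_preimage_gen cont open_Collect_less continuous_intros)
    ultimately show ?thesis by (simp only:) (intro openin_clauses(3) ballI; blast)
  qed
  then have Yb: "Y F q k \<in> sets borel" for F q k
    using X by (metis openin_open borel_open sets.Int)
  have char: "corthogonal_complement (range (g A)) \<inter> corthogonal_complement F = {0} \<longleftrightarrow>
    (\<forall>q\<in>E. \<forall>k. A \<in> Y F q k)" if A: "A \<in> X" for A F
  proof -
    define M where "M = {x + y |x y. x \<in> range (g A) \<and> y \<in> cspan F}"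
    have Mc: "csubspace M"
      unfolding M_def by (intro complex_vector.subspace_sums sub A complex_vector.subspace_span)
    have r0: "0 \<in> range (g A)" by (rule complex_vector.subspace_0[OF sub[OF A]])
    have perp: "corthogonal_complement (range (g A)) \<inter> corthogonal_complement F =
        {w. \<forall>y\<in>M. inner w y = 0}"
      unfolding corthogonal_complement_csubspace[OF Mc, symmetric]
    proof (intro subset_antisym subsetI)
      fix w assume w: "w \<in> corthogonal_complement (range (g A)) \<inter> corthogonal_complement F"
      then have "cinner w y = 0" if "y \<in> cspan F" for y
        using cinner_zero_on_cspan[OF _ that, of w] by (auto simp: corthogonal_complement_def)
      then show "w \<in> corthogonal_complement M"
        using w by (auto simp: corthogonal_complement_def M_def cinner_add_right)
    next
      fix w assume w: "w \<in> corthogonal_complement M"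
      have "x \<in> M" if "x \<in> range (g A)" for x
        using that complex_vector.span_zero[of F] by (force simp: M_def)
      moreover have "y \<in> M" if "y \<in> F" for y
        using that r0 complex_vector.span_base[of y F] by (force simp: M_def)
      ultimately show "w \<in> corthogonal_complement (range (g A)) \<inter> corthogonal_complement F"
        using w by (auto simp: corthogonal_complement_def)
    qed
    have "corthogonal_complement (range (g A)) \<inter> corthogonal_complement F = {0} \<longleftrightarrow> closure M = UNIV"
      unfolding perp subspace_dense_iff[OF csubspace_imp_subspace[OF Mc]] by auto
    also have "\<dots> \<longleftrightarrow> E \<subseteq> closure M"
      using E(2) closure_minimal[of E "closure M"] by auto
    also have "\<dots> \<longleftrightarrow> (\<forall>q. q \<in> E \<longrightarrow> (\<forall>k. \<exists>m\<in>M. dist m q < inverse (real (Suc k))))"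
      unfolding subset_iff closure_approachable
    proof (intro all_cong imp_cong refl iffI allI impI)
      fix q :: 'h and k :: nat assume "\<forall>e>0. \<exists>y\<in>M. dist y q < e"
      then show "\<exists>m\<in>M. dist m q < inverse (real (Suc k))" by simp
    next
      fix q :: 'h and r :: real
      assume *: "\<forall>k. \<exists>m\<in>M. dist m q < inverse (real (Suc k))" and "0 < r"
      then obtain k where "inverse (real (Suc k)) < r" using reals_Archimedean by blast
      then show "\<exists>m\<in>M. dist m q < r" using * by (meson less_trans)
    qed
    also have "\<dots> \<longleftrightarrow> (\<forall>q\<in>E. \<forall>k. A \<in> Y F q k)"
    proof -
      have "A \<in> Y F q k \<longleftrightarrow> (\<exists>m\<in>M. dist m q < inverse (real (Suc k)))" for q k
        unfolding Y_def M_def using A by blast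
      then show ?thesis by blast
    qed
    finally show ?thesis .
  qed
  have "{A \<in> X. hdim (corthogonal_complement (range (g A))) \<le> enat n} =
    (\<Union>F\<in>{F. finite F \<and> F \<subseteq> E \<and> card F \<le> n}. X \<inter> (\<Inter>q\<in>E. \<Inter>k. Y F q k))"
    using char corthogonal_complement_dense[OF E(2)]
    by (auto simp: hdim_le_iff_separating[OF csubspace_corthogonal_complement, where E = E])
  moreover have "countable {F. finite F \<and> F \<subseteq> E \<and> card F \<le> n}"
    by (rule countable_subset[OF _ countable_Collect_finite_subset[OF E(1)]]) auto
  moreover have "E \<noteq> {}" using E(2) by auto
  ultimately show ?thesis using X Yb E(1)
    by (auto intro!: sets.countable_UN' sets.countable_INT' sets.countable_INT sets.Int)
qed

lemma borel_enat_eq: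
  fixes d :: "'x::topological_space \<Rightarrow> enat"
  assumes X: "X \<in> sets borel" and le: "\<And>n. {A \<in> X. d A \<le> enat n} \<in> sets borel"
  shows "{A \<in> X. d A = m} \<in> sets borel"
proof (cases m)
  case (enat n)
  have "{A \<in> X. d A = m} = {A \<in> X. d A \<le> enat n} - (\<Union>k<n. {A \<in> X. d A \<le> enat k})"
  proof (intro subset_antisym subsetI)
    fix A assume "A \<in> {A \<in> X. d A \<le> enat n} - (\<Union>k<n. {A \<in> X. d A \<le> enat k})"
    then show "A \<in> {A \<in> X. d A = m}" by (cases "d A") (auto simp: enat)
  qed (auto simp: enat)
  also have "\<dots> \<in> sets borel" using le by auto
  finally show ?thesis .
next
  case infinity
  have "{A \<in> X. d A = m} = X - (\<Union>k. {A \<in> X. d A \<le> enat k})"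
  proof (intro subset_antisym subsetI)
    fix A assume "A \<in> X - (\<Union>k. {A \<in> X. d A \<le> enat k})"
    then show "A \<in> {A \<in> X. d A = m}" by (cases "d A") (auto simp: infinity)
  qed (auto simp: infinity)
  also have "\<dots> \<in> sets borel" using le X by auto
  finally show ?thesis .
qed

section \<open>Kernel, cokernel and closed range as Borel conditions on bounded operators\<close>

lemma closed_BH: "closed (BH :: ('h::complex_hilbert \<Rightarrow>\<^sub>L 'h) set)"
proof -
  have eq: "BH = (\<Inter>c. \<Inter>x. {A :: 'h \<Rightarrow>\<^sub>L 'h. blinfun_apply A (c *\<^sub>C x) = c *\<^sub>C blinfun_apply A x})"
    by (auto simp: BH_def)
  have "closed {A :: 'h \<Rightarrow>\<^sub>L 'h. blinfun_apply A (c *\<^sub>C x) = c *\<^sub>C blinfun_apply A x}" for c x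
    by (intro closed_Collect_eq continuous_intros
        bounded_linear.continuous_on[OF bounded_linear_scaleC_right])
  then show ?thesis unfolding eq by blast
qed

lemma BH_scaleC: "A \<in> BH \<Longrightarrow> blinfun_apply A (c *\<^sub>C x) = c *\<^sub>C blinfun_apply A x"
  by (simp add: BH_def)

lemma csubspace_range_BH: "A \<in> BH \<Longrightarrow> csubspace (range (blinfun_apply A))"
  unfolding complex_vector.subspace_def
  by (auto simp flip: blinfun.add_right BH_scaleC intro: range_eqI[of _ _ 0])

lemma inner_scaleC_cnj: "inner (c *\<^sub>C x) y = inner x (cnj c *\<^sub>C (y::'a::complex_hilbert))"
  by (simp add: inner_eq_Re_cinner cinner_scaleC_left cinner_scaleC_right)

text \<open>The scalar crosses the real inner product as its conjugate, passes through the
  complex-linear \<open>A\<close>, and crosses back.\<close>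

lemma hadjoint_scaleC: "A \<in> BH \<Longrightarrow> hadjoint A (c *\<^sub>C y) = c *\<^sub>C hadjoint A y"
proof (rule hadjoint_unique)
  fix x assume A: "A \<in> BH"
  have "inner (blinfun_apply A x) (c *\<^sub>C y) = inner (blinfun_apply A (cnj c *\<^sub>C x)) y"
    by (simp add: inner_scaleC_cnj BH_scaleC[OF A])
  then show "inner (blinfun_apply A x) (c *\<^sub>C y) = inner x (c *\<^sub>C hadjoint A y)"
    by (simp add: inner_hadjoint inner_scaleC_cnj)
qed

lemma csubspace_range_hadjoint: "A \<in> BH \<Longrightarrow> csubspace (range (hadjoint A))"
  unfolding complex_vector.subspace_def
  by (auto simp flip: hadjoint_add hadjoint_scaleC
      intro: range_eqI[of _ _ 0] simp: linear_simps(3)[OF bounded_linear_hadjoint])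

text \<open>Testing \<open>x\<close> against \<open>hadjoint A (A x)\<close> yields the squared norm
  of \<open>A x\<close>. Kernels thereby fall under the measurability result for complements of
  ranges.\<close>

lemma corthogonal_complement_range_hadjoint:
  assumes "A \<in> BH"
  shows "corthogonal_complement (range (hadjoint A)) = {x. blinfun_apply A x = 0}"
  unfolding corthogonal_complement_csubspace[OF csubspace_range_hadjoint[OF assms]]
proof (intro subset_antisym subsetI)
  fix x assume "x \<in> {w. \<forall>y\<in>range (hadjoint A). inner w y = 0}"
  then have "inner (blinfun_apply A x) (blinfun_apply A x) = 0" by (simp add: inner_hadjoint)
  then show "x \<in> {x. blinfun_apply A x = 0}" by simp
qed (auto simp flip: inner_hadjoint)

lemma borel_hdim_kernel:
  assumes "countable E" "closure E = (UNIV :: 'h::complex_hilbert set)"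
  shows "{A \<in> (BH :: ('h \<Rightarrow>\<^sub>L 'h) set). hdim {x. blinfun_apply A x = 0} = n} \<in> sets borel"
proof (rule borel_enat_eq)
  show BH: "(BH :: ('h \<Rightarrow>\<^sub>L 'h) set) \<in> sets borel" by (simp add: closed_BH borel_closed)
  show "{A \<in> (BH :: ('h \<Rightarrow>\<^sub>L 'h) set). hdim {x. blinfun_apply A x = 0} \<le> enat m} \<in> sets borel" for m
    using borel_hdim_complement_le[OF assms BH continuous_on_hadjoint csubspace_range_hadjoint, of m]
    by (simp add: corthogonal_complement_range_hadjoint cong: conj_cong)
qed

lemma borel_hdim_cokernel:
  assumes "countable E" "closure E = (UNIV :: 'h::complex_hilbert set)"
  shows "{A \<in> (BH :: ('h \<Rightarrow>\<^sub>L 'h) set). hdim (corthogonal_complement (range (blinfun_apply A))) = m}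
    \<in> sets borel"
proof (rule borel_enat_eq)
  show BH: "(BH :: ('h \<Rightarrow>\<^sub>L 'h) set) \<in> sets borel" by (simp add: closed_BH borel_closed)
  show "{A \<in> (BH :: ('h \<Rightarrow>\<^sub>L 'h) set).
      hdim (corthogonal_complement (range (blinfun_apply A))) \<le> enat m} \<in> sets borel" for m
    by (rule borel_hdim_complement_le[OF assms BH _ csubspace_range_BH])
      (intro continuous_intros, assumption)
qed

text \<open>For each \<open>k\<close> both sides of the criterion are continuous in \<open>A\<close>
  at fixed \<open>x\<close>, so its validity for all \<open>x\<close> is a closed condition;
  \<open>k\<close> then ranges over a countable union.\<close>

lemma borel_closed_range:
  "{A :: 'a::{real_inner,banach} \<Rightarrow>\<^sub>L 'b::{real_inner,banach}. closed (range (blinfun_apply A))} \<in> sets borel"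
proof -
  have "closed {A :: 'a \<Rightarrow>\<^sub>L 'b. \<forall>x. norm (blinfun_apply A x) \<le>
      real k * norm (hadjoint A (blinfun_apply A x))}" for k :: nat
    by (intro closed_Collect_all closed_Collect_le continuous_intros
        continuous_on_hadjoint_apply)
  moreover have "{A :: 'a \<Rightarrow>\<^sub>L 'b. closed (range (blinfun_apply A))} = (\<Union>k::nat.
      {A. \<forall>x. norm (blinfun_apply A x) \<le> real k * norm (hadjoint A (blinfun_apply A x))})"
    by (auto simp: closed_range_iff)
  ultimately show ?thesis by (auto intro: borel_closed)
qed


section \<open>Borel classes and the operator pencil\<close>

instantiation prod :: (complex_vector, complex_vector) complex_vector
begin

definition scaleC_prod_def: "c *\<^sub>C p = (c *\<^sub>C fst p, c *\<^sub>C snd p)"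

instance
  by standard
    (auto simp: scaleC_prod_def scaleC_add_right scaleC_add_left scaleC_scaleC scaleC_one
      scaleR_prod_def scaleR_scaleC)

end

instantiation prod :: (complex_hilbert, complex_hilbert) complex_hilbert
begin

definition cinner_prod_def: "cinner p q = cinner (fst p) (fst q) + cinner (snd p) (snd q)"

instance
proof
  show "cinner x y = cnj (cinner y x)" for x y :: "'a \<times> 'b"
    unfolding cinner_prod_def by (simp flip: cinner_commute)
qed (auto simp: cinner_prod_def scaleC_prod_def cinner_add_left cinner_scaleC_left
    inner_prod_def inner_eq_Re_cinner algebra_simps)

end

section \<open>Borel classes under continuous preimages\<close>

text \<open>Preimages commute with countable unions, and also with complements because
  \<open>f\<close> maps \<open>topspace Y\<close> into \<open>topspace X\<close>; the index
  \<open>a\<close> is therefore unchanged throughout the induction.\<close>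

lemma borel_additive_preimage:
  assumes "borel_additive X r a S" and f: "continuous_map Y X f"
  shows "borel_additive Y r a {y \<in> topspace Y. f y \<in> S}"
  using assms(1)
proof (induction rule: borel_additive.induct)
  case (base a S)
  then show ?case using f by (auto intro: borel_additive.base openin_continuous_map_preimage)
next
  case (step a F)
  have "{y \<in> topspace Y. f y \<in> (\<Union>k. F k)} = (\<Union>k. {y \<in> topspace Y. f y \<in> F k})" by auto
  moreover have "borel_additive Y r a (\<Union>k. {y \<in> topspace Y. f y \<in> F k})"
  proof (rule borel_additive.step[OF step.hyps(1,2)], intro conjI)
    fix k
    have "topspace Y - {y \<in> topspace Y. f y \<in> F k} = {y \<in> topspace Y. f y \<in> topspace X - F k}"
      using continuous_map_image_subset_topspace[OF f] by auto
    then show "\<exists>b\<in>underS r a. borel_additive Y r b (topspace Y - {y \<in> topspace Y. f y \<in> F k})"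
      using step.IH[of k] by auto
  qed auto
  ultimately show ?case by simp
qed

lemma fsigma_in_preimage:
  assumes "fsigma_in X S" and f: "continuous_map Y X f"
  shows "fsigma_in Y {y \<in> topspace Y. f y \<in> S}"
proof -
  obtain C :: "nat \<Rightarrow> _" where C: "\<And>n. closedin X (C n)" "S = \<Union> (range C)"
    using assms(1) unfolding fsigma_in_ascending by metis
  have "fsigma_in Y (\<Union>n. {y \<in> topspace Y. f y \<in> C n})"
    by (rule fsigma_in_Union)
      (auto intro!: closed_imp_fsigma_in closedin_continuous_map_preimage[OF f] C)
  moreover have "(\<Union>n. {y \<in> topspace Y. f y \<in> C n}) = {y \<in> topspace Y. f y \<in> S}"
    using C(2) by auto
  ultimately show ?thesis by simp
qed

lemma gdelta_in_preimage:
  assumes "gdelta_in X S" and f: "continuous_map Y X f"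
  shows "gdelta_in Y {y \<in> topspace Y. f y \<in> S}"
proof -
  have "topspace Y - {y \<in> topspace Y. f y \<in> S} = {y \<in> topspace Y. f y \<in> topspace X - S}"
    using continuous_map_image_subset_topspace[OF f] by auto
  then show ?thesis
    using fsigma_in_preimage[OF _ f, of "topspace X - S"] assms(1) by (auto simp: gdelta_in_fsigma_in)
qed

lemma same_borel_class_preimage:
  assumes f: "continuous_map Y X f"
  shows "same_borel_class X S Y {y \<in> topspace Y. f y \<in> S}"
  unfolding same_borel_class_def
proof (intro conjI allI impI)
  fix r :: "nat rel" and a
  show "borel_additive Y r a {y \<in> topspace Y. f y \<in> S}" if "borel_additive X r a S"
    using borel_additive_preimage[OF that f] .
  show "borel_multiplicative Y r a {y \<in> topspace Y. f y \<in> S}" if "borel_multiplicative X r a S"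
  proof -
    have "topspace Y - {y \<in> topspace Y. f y \<in> S} = {y \<in> topspace Y. f y \<in> topspace X - S}"
      using continuous_map_image_subset_topspace[OF f] by auto
    then show ?thesis
      using that borel_additive_preimage[OF _ f, of r a "topspace X - S"]
      by (auto simp: borel_multiplicative_def)
  qed
next
  assume "closed_inter_open_in X S"
  then obtain C U where "closedin X C" "openin X U" "S = C \<inter> U" by (auto simp: closed_inter_open_in_def)
  then show "closed_inter_open_in Y {y \<in> topspace Y. f y \<in> S}"
    unfolding closed_inter_open_in_def
    by (intro exI[of _ "{y \<in> topspace Y. f y \<in> C}"] exI[of _ "{y \<in> topspace Y. f y \<in> U}"])
      (auto intro: closedin_continuous_map_preimage[OF f] openin_continuous_map_preimage[OF f])
next
  assume "fsigma_inter_gdelta_in X S"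
  then obtain C U where "fsigma_in X C" "gdelta_in X U" "S = C \<inter> U"
    by (auto simp: fsigma_inter_gdelta_in_def)
  then show "fsigma_inter_gdelta_in Y {y \<in> topspace Y. f y \<in> S}"
    unfolding fsigma_inter_gdelta_in_def
    by (intro exI[of _ "{y \<in> topspace Y. f y \<in> C}"] exI[of _ "{y \<in> topspace Y. f y \<in> U}"])
      (auto intro: fsigma_in_preimage[OF _ f] gdelta_in_preimage[OF _ f])
qed

section \<open>The operators \<open>T - z\<close> and their replacement by bounded operators\<close>

lemma densely_defined_not_finite_dim:
  fixes D :: "'h::complex_hilbert set"
  assumes "hdim (UNIV :: 'h set) = \<infinity>" "densely_defined D" "finite B"
  shows "\<not> D \<subseteq> cspan B"
proof
  assume "D \<subseteq> cspan B"
  then have "UNIV \<subseteq> cspan B"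
    using assms(2) closure_minimal[OF _ closed_cspan_finite[OF assms(3)]]
    by (auto simp: densely_defined_def)
  then show False using assms(1,3) by (auto simp: hdim_eq_infinity_iff)
qed

text \<open>The difference of \<open>T - z\<close> and \<open>T - w\<close> is multiplication by
  \<open>w - z\<close>, so for distinct points the dense domain would lie in the sum of two
  finite-dimensional ranges.\<close>

lemma sigma_fin_unique:
  fixes D :: "'h::complex_hilbert set"
  assumes inf: "hdim (UNIV :: 'h set) = \<infinity>" and D: "densely_defined D"
    and zw: "z \<in> sigma_fin D T" "w \<in> sigma_fin D T"
  shows "z = w"
proof (rule ccontr)
  assume "z \<noteq> w"
  obtain B C where B: "finite B" "op_range D (\<lambda>x. T x - z *\<^sub>C x) \<subseteq> cspan B"
    and C: "finite C" "op_range D (\<lambda>x. T x - w *\<^sub>C x) \<subseteq> cspan C"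
    using zw by (auto simp: sigma_fin_def hdim_eq_infinity_iff)
  have "x \<in> cspan (B \<union> C)" if "x \<in> D" for x
  proof -
    have "T x - z *\<^sub>C x \<in> cspan (B \<union> C)" "T x - w *\<^sub>C x \<in> cspan (B \<union> C)"
      using that B(2) C(2) complex_vector.span_mono[of _ "B \<union> C"]
      by (auto simp: op_range_def)
    then have "(T x - z *\<^sub>C x) - (T x - w *\<^sub>C x) \<in> cspan (B \<union> C)" by (rule complex_vector.span_diff)
    then have "(w - z) *\<^sub>C x \<in> cspan (B \<union> C)" by (simp add: scaleC_diff_left)
    then have "inverse (w - z) *\<^sub>C ((w - z) *\<^sub>C x) \<in> cspan (B \<union> C)"
      by (rule complex_vector.span_scale)
    moreover have "inverse (w - z) *\<^sub>C ((w - z) *\<^sub>C x) = x"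
      using \<open>z \<noteq> w\<close> unfolding scaleC_scaleC by (simp add: scaleC_one)
    ultimately show ?thesis by (simp only:)
  qed
  then show False
    using densely_defined_not_finite_dim[OF inf D, of "B \<union> C"] B(1) C(1) by auto
qed

lemma separable_space_dense_set:
  assumes "separable_space (euclidean :: 'a::topological_space topology)"
  obtains Q :: "'a::topological_space set" where "countable Q" "closure Q = UNIV"
  using assms by (auto simp: separable_space_def)

lemma bounded_pencil_exists:
  fixes D :: "'h::complex_hilbert set" and T :: "'h \<Rightarrow> 'h"
  assumes sep: "separable_space (euclidean :: 'h topology)"
    and inf: "hdim (UNIV :: 'h set) = \<infinity>"
    and T: "closed_operator D T" and D: "densely_defined D"
  obtains A :: "complex \<Rightarrow> 'h \<Rightarrow>\<^sub>L 'h" where "continuous_on UNIV A" "range A \<subseteq> BH"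
    "\<And>z. range (blinfun_apply (A z)) = op_range D (\<lambda>x. T x - z *\<^sub>C x)"
    "\<And>z. hdim {x. blinfun_apply (A z) x = 0} = hdim (op_kernel D (\<lambda>x. T x - z *\<^sub>C x))"
proof -
  define G where "G = {(x, T x) |x. x \<in> D}"
  have clG: "closed G" and Ds: "csubspace D"
    and Tadd: "\<And>x y. x \<in> D \<Longrightarrow> y \<in> D \<Longrightarrow> T (x + y) = T x + T y"
    and Tscale: "\<And>c x. x \<in> D \<Longrightarrow> T (c *\<^sub>C x) = c *\<^sub>C T x"
    using T by (auto simp: closed_operator_def is_operator_def G_def)
  have D0: "0 \<in> D" using complex_vector.subspace_0[OF Ds] .
  have T0: "T 0 = 0" using Tscale[OF D0, of 0] by simp
  have sG: "csubspace G"
    unfolding complex_vector.subspace_def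
  proof (intro conjI ballI allI)
    show "0 \<in> G" using D0 T0 by (auto simp: G_def zero_prod_def)
    show "p + q \<in> G" if "p \<in> G" "q \<in> G" for p q
      using that complex_vector.subspace_add[OF Ds] by (auto simp: G_def Tadd)
    show "c *\<^sub>C p \<in> G" if "p \<in> G" for c p
      using that complex_vector.subspace_scale[OF Ds] by (auto simp: G_def Tscale scaleC_prod_def)
  qed
  \<comment> \<open>The first projection maps the graph onto \<open>D\<close>, which is not
    contained in a finite span.\<close>
  have infG: "\<not> G \<subseteq> cspan B" if fin: "finite B" for B
  proof
    assume "G \<subseteq> cspan B"
    then have "fst ` G \<subseteq> fst ` cspan B" by (rule image_mono)
    also have "\<dots> = cspan (fst ` B)" by (rule cspan_image) (auto simp: scaleC_prod_def)
    finally have "D \<subseteq> cspan (fst ` B)" by (force simp: G_def)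
    then show False using densely_defined_not_finite_dim[OF inf D, of "fst ` B"] fin by auto
  qed
  obtain Q :: "'h set" where Q: "countable Q" "closure Q = UNIV"
    using separable_space_dense_set[OF sep] .
  obtain e where e: "orthonormal_basis_of (UNIV :: 'h set) e"
    using orthonormal_basis_exists[OF complex_vector.subspace_UNIV Q] inf
    by (auto simp: hdim_eq_infinity_iff)
  obtain f where f: "orthonormal_basis_of G f"
    using orthonormal_basis_exists[OF sG _ _ infG, of "Q \<times> Q"] Q by (auto simp: closure_Times)
  obtain U :: "'h \<Rightarrow> 'h \<times> 'h" where U: "bounded_linear U" "\<And>c x. U (c *\<^sub>C x) = c *\<^sub>C U x"
    "\<And>x. norm (U x) = norm x" "range U = G"
    using isometric_isomorphism_exists[OF e f sG clG] by blast
  interpret U: bounded_linear U by (rule U(1))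
  define P where "P x = fst (U x)" for x
  define S where "S x = snd (U x)" for x
  have Padd: "P (x + y) = P x + P y" and Pscale: "P (c *\<^sub>C x) = c *\<^sub>C P x"
    and Sscale: "S (c *\<^sub>C x) = c *\<^sub>C S x" for x y c
    by (simp_all add: P_def S_def U.add U(2) scaleC_prod_def)
  have UG: "U x \<in> G" for x using U(4) by blast
  have PD: "P x \<in> D" and SP: "S x = T (P x)" for x
    using UG[of x] by (force simp: P_def S_def G_def)+
  have Psurj: "\<exists>x. y = P x" if "y \<in> D" for y
  proof -
    have "(y, T y) \<in> range U" using that by (auto simp: U(4) G_def)
    then show ?thesis by (auto simp: P_def) (metis fst_conv)
  qed
  have Pinj: "inj P"
  proof (rule injI)
    \<comment> \<open>On a graph the first component determines the second, so
      \<open>U x = U y\<close>, and \<open>U\<close> is isometric.\<close>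
    fix x y assume "P x = P y"
    then have "U x = U y" using SP[of x] SP[of y] by (simp add: P_def S_def prod_eq_iff)
    then have "norm (U (x - y)) = 0" by (simp add: U.diff)
    then show "x = y" by (simp add: U(3))
  qed
  have blP: "bounded_linear P" and blS: "bounded_linear S"
    unfolding P_def S_def by (intro bounded_linear_compose[OF _ U(1)] bounded_linear_fst bounded_linear_snd)+
  define A where "A z = Blinfun (\<lambda>x. S x - z *\<^sub>C P x)" for z
  have A: "blinfun_apply (A z) x = S x - z *\<^sub>C P x" for z x
    unfolding A_def
    by (subst bounded_linear_Blinfun_apply)
      (auto intro!: bounded_linear_sub blS bounded_linear_compose[OF bounded_linear_scaleC_right blP])
  \<comment> \<open>\<open>P\<close> is a component of the isometry \<open>U\<close>, hence a
    contraction, which gives the Lipschitz constant 1.\<close>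
  have "1-lipschitz_on UNIV A"
  proof (rule lipschitz_onI)
    fix z w
    have "norm (A z - A w) \<le> dist z w"
    proof (rule norm_blinfun_bound)
      fix x
      have "blinfun_apply (A z - A w) x = (w - z) *\<^sub>C P x"
        by (simp add: blinfun.diff_left A scaleC_diff_left)
      moreover have "norm (P x) \<le> norm x"
        using norm_fst_le[of "fst (U x)" "snd (U x)"] by (simp add: P_def U(3))
      ultimately show "norm (blinfun_apply (A z - A w) x) \<le> dist z w * norm x"
        by (simp add: dist_norm norm_minus_commute mult_left_mono)
    qed simp
    then show "dist (A z) (A w) \<le> 1 * dist z w" by (simp add: dist_norm)
  qed simp
  then have "continuous_on UNIV A" by (rule lipschitz_on_continuous_on)
  moreover have "range A \<subseteq> BH"
    by (auto simp: BH_def A Sscale Pscale scaleC_diff_right scaleC_scaleC mult.commute)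
  moreover have "range (blinfun_apply (A z)) = op_range D (\<lambda>x. T x - z *\<^sub>C x)" for z
  proof (intro subset_antisym subsetI)
    fix y assume "y \<in> op_range D (\<lambda>x. T x - z *\<^sub>C x)"
    then obtain x where "y = T (P x) - z *\<^sub>C P x" using Psurj by (auto simp: op_range_def)
    then show "y \<in> range (blinfun_apply (A z))" by (auto simp: A SP)
  qed (auto simp: op_range_def A SP PD)
  moreover have "hdim {x. blinfun_apply (A z) x = 0} = hdim (op_kernel D (\<lambda>x. T x - z *\<^sub>C x))" for z
  proof -
    \<comment> \<open>\<open>P\<close> need not be isometric, but an injective linear map already
      preserves \<open>hdim\<close>.\<close>
    have "op_kernel D (\<lambda>x. T x - z *\<^sub>C x) = P ` {x. blinfun_apply (A z) x = 0}"
      using Psurj by (fastforce simp: op_kernel_def A SP PD)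
    moreover have "csubspace {x. blinfun_apply (A z) x = 0}"
      using csubspace_corthogonal_complement[of "range (hadjoint (A z))"] \<open>range A \<subseteq> BH\<close>
      by (simp add: corthogonal_complement_range_hadjoint image_subset_iff)
    ultimately show ?thesis using hdim_linear_image[OF Padd Pscale Pinj] by simp
  qed
  ultimately show thesis using that by blast
qed

theorem proposition5p5:
  fixes D :: "'h::complex_hilbert set" and T :: "'h \<Rightarrow> 'h"
  assumes "separable_space (euclidean :: 'h topology)"
    and "hdim (UNIV :: 'h set) = \<infinity>"
    and "closed_operator D T"
    and "densely_defined D"
  shows "(\<forall>S \<in> Sigma_family D T. S \<in> sets borel) \<and>
    (\<exists>z. sigma_fin D T \<subseteq> {z}) \<and>
    (\<forall>j \<in> {0, 1}. \<forall>n m.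
      same_borel_class (top_of_set (BH :: ('h \<Rightarrow>\<^sub>L 'h) set)) (Sigma_op j n m)
        euclidean (sigma_op j n m D T))"
proof -
  obtain A :: "complex \<Rightarrow> 'h \<Rightarrow>\<^sub>L 'h" where cont: "continuous_on UNIV A" and BH: "range A \<subseteq> BH"
    and ran: "\<And>z. range (blinfun_apply (A z)) = op_range D (\<lambda>x. T x - z *\<^sub>C x)"
    and ker: "\<And>z. hdim {x. blinfun_apply (A z) x = 0} = hdim (op_kernel D (\<lambda>x. T x - z *\<^sub>C x))"
    using bounded_pencil_exists[OF assms] by blast
  have BHz: "A z \<in> BH" for z using BH by auto
  obtain Q :: "'h set" where Q: "countable Q" "closure Q = UNIV"
    using separable_space_dense_set[OF assms(1)] .
  have fin: "\<exists>z. sigma_fin D T \<subseteq> {z}"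
    using sigma_fin_unique[OF assms(2,4)] by (metis insertI1 subsetI)
  \<comment> \<open>A set with at most one point is finite, hence closed.\<close>
  then have fin_borel: "sigma_fin D T \<in> sets borel"
    by (metis borel_closed finite.emptyI finite_imp_closed finite_insert finite_subset)
  have preimage: "{z. A z \<in> X} \<in> sets borel" if "X \<in> sets borel" for X
    using measurable_sets[OF borel_measurable_continuous_onI[OF cont] that] by (simp add: vimage_def)
  have op_borel: "sigma_op j n m D T \<in> sets borel" for j n m
  proof -
    define C where "C = {A :: 'h \<Rightarrow>\<^sub>L 'h. closed (range (blinfun_apply A))}"
    have C: "(if j = 1 then C else - C) \<in> sets borel"
      using borel_closed_range[where 'a = 'h and 'b = 'h] by (auto simp: C_def borel_comp)
    \<comment> \<open>By \<open>hdim_closure\<close> the condition on the closed range says that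
      \<open>z\<close> is outside \<open>sigma_fin\<close>. The remaining conditions are preimages
      under \<open>A\<close> of Borel sets of operators.\<close>
    have "sigma_op j n m D T =
      {z. A z \<in> {A \<in> BH. hdim {x. blinfun_apply A x = 0} = n}} \<inter>
      {z. A z \<in> {A \<in> BH. hdim (corthogonal_complement (range (blinfun_apply A))) = m}} \<inter>
      - sigma_fin D T \<inter> {z. A z \<in> (if j = 1 then C else - C)}"
      by (auto simp: sigma_op_def op_type_def sigma_fin_def hdim_closure ker ran BHz C_def)
    also have "\<dots> \<in> sets borel"
      by (intro sets.Int preimage borel_hdim_kernel[OF Q] borel_hdim_cokernel[OF Q] C
          borel_comp fin_borel)
    finally show ?thesis .
  qed
  have "continuous_map euclidean (top_of_set BH) A"
    using cont BHz by (auto simp: continuous_map_in_subtopology)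
  \<comment> \<open>Apart from the kernel dimension, \<open>op_type\<close> depends only on the
    range, which \<open>A z\<close> shares with \<open>T - z\<close>.\<close>
  moreover have "{z \<in> topspace euclidean. A z \<in> Sigma_op j n m} = sigma_op j n m D T" for j n m
    using ker by (auto simp: Sigma_op_def sigma_op_def op_type_def op_range_def op_kernel_def ran BHz)
  ultimately have "same_borel_class (top_of_set (BH :: ('h \<Rightarrow>\<^sub>L 'h) set)) (Sigma_op j n m)
      euclidean (sigma_op j n m D T)" for j n m
    using same_borel_class_preimage[of euclidean "top_of_set BH" A "Sigma_op j n m"] by simp
  then show ?thesis using fin fin_borel op_borel by (auto simp: Sigma_family_def)
qed

end
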